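(* Let $(V,\circ,e)$ be a finite-dimensional Euclidean Jordan algebra over $\mathbb{R}$ with identity element $e$ and rank $r$, let $\Omega$ be the interior of its cone of squares, and let $L\subseteq V$ be a linear subspace with $L\cap\Omega\ne\emptyset$. Assume $z\in\bar\Omega\setminus\{0\}$ is such that $\|(P_Lz)^+\|_F\le\epsilon\|z\|$. Let $c\in V$ be a primitive idempotent such that $z\circ c=\lambda_{\max}(z)c$, and let $D_v:V\to V$ be the quadratic mapping associated to $v=e+ac$, i.e. $D_vx=2v\circ(v\circ x)-v^2\circ x$, for some constant $a>0$. Then $$\delta(D_v(L)\cap\Omega)\ \ge\ \frac{(1+a)^2}{(1+(2a+a^2)\epsilon)^r}\cdot\delta(L\cap\Omega).$$ In particular, if $\epsilon=\frac1{4r}$ and $a=\sqrt2-1$, then $\delta(D_v(L)\cap\Omega)\ge1.5\cdot\delta(L\cap\Omega)$.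
   Context: Euclidean Jordan algebra: $\circ:V\times V\to V$ is bilinear and commutative, $x\circ(x^2\circ y)=x^2\circ(x\circ y)$ with $x^2=x\circ x$, $x\circ e=x$, and there is an associative positive definite bilinear form on $V$. The rank $r$ is the smallest integer such that $\{e,x,\dots,x^r\}$ is linearly dependent for all $x\in V$. Every $x\in V$ has a spectral decomposition $x=\sum_{i=1}^r\lambda_i(x)c_i$, where $\{c_1,\dots,c_r\}$ is a Jordan frame (non-zero primitive idempotents, $c_i\circ c_j=0$ for $i\ne j$, $\sum_i c_i=e$); an idempotent is primitive if it is not the sum of two other (non-zero) idempotents; primitive idempotents are taken non-zero. Put $\mathrm{trace}(x)=\sum_i\lambda_i(x)$, $\det(x)=\prod_i\lambda_i(x)$. $V$ carries the inner product $\langle x,y\rangle=\mathrm{trace}(x\circ y)$; $\|x\|_F=\sqrt{\langle x,x\rangle}=\|\lambda(x)\|_2$, $\|x\|=\|\lambda(x)\|_\infty$, $\lambda_{\max}(x)=\max_i\lambda_i(x)$. $\Omega=\mathrm{int}\{x^2:x\in V\}$, $\bar\Omega$ is its closure, and $v^+$ denotes the orthogonal projection of $v\in V$ onto $\bar\Omega$, i.e. $v^+=\sum_i\max\{\lambda_i(v),0\}c_i$. $P_L$ is the orthogonal projection onto $L$ with respect to $\langle\cdot,\cdot\rangle$. Condition measure, for a subspace $M\subseteq V$ with $M\cap\Omega\ne\emptyset$: $\delta(M\cap\Omega)=\max\{\det(x):x\in M\cap\Omega,\ \|x\|_F^2=r\}$. *)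

theory Defs
  imports "HOL-Analysis.Analysis"
begin

(* The class euclidean_space supplies finite dimension and the (unique) vector space topology.
   Its inner product and norm play no other role: the inner product of the algebra is
   the trace form jinner below. *)
locale euclidean_jordan_algebra =
  fixes jp :: "'a::euclidean_space \<Rightarrow> 'a \<Rightarrow> 'a" (infixl "\<odot>" 70)
    and e :: 'a
  assumes bilinear: "bilinear (\<odot>)"
    and commute: "x \<odot> y = y \<odot> x"
    and jordan: "x \<odot> ((x \<odot> x) \<odot> y) = (x \<odot> x) \<odot> (x \<odot> y)"
    and unit: "x \<odot> e = x"
    and form: "\<exists>B :: 'a \<Rightarrow> 'a \<Rightarrow> real. bilinear B \<and>
                 (\<forall>x y z. B (x \<odot> y) z = B x (y \<odot> z)) \<and> (\<forall>x. x \<noteq> 0 \<longrightarrow> B x x > 0)"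

primrec jpower :: "('a::euclidean_space \<Rightarrow> 'a \<Rightarrow> 'a) \<Rightarrow> 'a \<Rightarrow> 'a \<Rightarrow> nat \<Rightarrow> 'a" where
  "jpower jp e x 0 = e"
| "jpower jp e x (Suc n) = jp x (jpower jp e x n)"

(* Linear dependence of the family (x^0, ..., x^r), which may have repeated members; hence
   explicit coefficients rather than the set predicate dependent. *)
definition jrank :: "('a::euclidean_space \<Rightarrow> 'a \<Rightarrow> 'a) \<Rightarrow> 'a \<Rightarrow> nat" where
  "jrank jp e = (LEAST r. \<forall>x. \<exists>u :: nat \<Rightarrow> real.
     (\<exists>i\<le>r. u i \<noteq> 0) \<and> (\<Sum>i\<le>r. u i *\<^sub>R jpower jp e x i) = 0)"

definition jidempotent :: "('a::euclidean_space \<Rightarrow> 'a \<Rightarrow> 'a) \<Rightarrow> 'a \<Rightarrow> bool" where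
  "jidempotent jp c \<longleftrightarrow> jp c c = c"

definition primitive_idempotent :: "('a::euclidean_space \<Rightarrow> 'a \<Rightarrow> 'a) \<Rightarrow> 'a \<Rightarrow> bool" where
  "primitive_idempotent jp c \<longleftrightarrow> jidempotent jp c \<and> c \<noteq> 0 \<and>
     \<not> (\<exists>p q. jidempotent jp p \<and> jidempotent jp q \<and> p \<noteq> 0 \<and> q \<noteq> 0 \<and> c = p + q)"

definition jordan_frame :: "('a::euclidean_space \<Rightarrow> 'a \<Rightarrow> 'a) \<Rightarrow> 'a \<Rightarrow> (nat \<Rightarrow> 'a) \<Rightarrow> bool" where
  "jordan_frame jp e c \<longleftrightarrow>
     (\<forall>i<jrank jp e. primitive_idempotent jp (c i)) \<and>
     (\<forall>i<jrank jp e. \<forall>j<jrank jp e. i \<noteq> j \<longrightarrow> jp (c i) (c j) = 0) \<and>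
     (\<Sum>i<jrank jp e. c i) = e"

(* The spectral decomposition determines the eigenvalues only up to order (and only the indices
   i < jrank jp e matter); everything below is symmetric in them, so any choice will do. *)
definition jeig :: "('a::euclidean_space \<Rightarrow> 'a \<Rightarrow> 'a) \<Rightarrow> 'a \<Rightarrow> 'a \<Rightarrow> nat \<Rightarrow> real" where
  "jeig jp e x = (SOME l. \<exists>c. jordan_frame jp e c \<and> x = (\<Sum>i<jrank jp e. l i *\<^sub>R c i))"

definition jtrace :: "('a::euclidean_space \<Rightarrow> 'a \<Rightarrow> 'a) \<Rightarrow> 'a \<Rightarrow> 'a \<Rightarrow> real" where
  "jtrace jp e x = (\<Sum>i<jrank jp e. jeig jp e x i)"

definition jdet :: "('a::euclidean_space \<Rightarrow> 'a \<Rightarrow> 'a) \<Rightarrow> 'a \<Rightarrow> 'a \<Rightarrow> real" where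
  "jdet jp e x = (\<Prod>i<jrank jp e. jeig jp e x i)"

definition jlambda_max :: "('a::euclidean_space \<Rightarrow> 'a \<Rightarrow> 'a) \<Rightarrow> 'a \<Rightarrow> 'a \<Rightarrow> real" where
  "jlambda_max jp e x = Max (jeig jp e x ` {..<jrank jp e})"

definition jinner :: "('a::euclidean_space \<Rightarrow> 'a \<Rightarrow> 'a) \<Rightarrow> 'a \<Rightarrow> 'a \<Rightarrow> 'a \<Rightarrow> real" where
  "jinner jp e x y = jtrace jp e (jp x y)"

definition jnorm_F :: "('a::euclidean_space \<Rightarrow> 'a \<Rightarrow> 'a) \<Rightarrow> 'a \<Rightarrow> 'a \<Rightarrow> real" where
  "jnorm_F jp e x = sqrt (jinner jp e x x)"

definition jnorm_inf :: "('a::euclidean_space \<Rightarrow> 'a \<Rightarrow> 'a) \<Rightarrow> 'a \<Rightarrow> 'a \<Rightarrow> real" where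
  "jnorm_inf jp e x = Max ((\<lambda>i. \<bar>jeig jp e x i\<bar>) ` {..<jrank jp e})"

definition jcone :: "('a::euclidean_space \<Rightarrow> 'a \<Rightarrow> 'a) \<Rightarrow> 'a set" where
  "jcone jp = interior (range (\<lambda>x. jp x x))"

definition jproj :: "('a::euclidean_space \<Rightarrow> 'a \<Rightarrow> 'a) \<Rightarrow> 'a \<Rightarrow> 'a set \<Rightarrow> 'a \<Rightarrow> 'a" where
  "jproj jp e L x = (THE p. p \<in> L \<and> (\<forall>y\<in>L. jinner jp e (x - p) y = 0))"

(* The projection onto the closed convex cone, i.e. the nearest point with respect to jnorm_F. *)
definition jpos_part :: "('a::euclidean_space \<Rightarrow> 'a \<Rightarrow> 'a) \<Rightarrow> 'a \<Rightarrow> 'a \<Rightarrow> 'a" where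
  "jpos_part jp e v = (THE p. p \<in> closure (jcone jp) \<and>
     (\<forall>q\<in>closure (jcone jp). jnorm_F jp e (v - p) \<le> jnorm_F jp e (v - q)))"

definition jquad :: "('a::euclidean_space \<Rightarrow> 'a \<Rightarrow> 'a) \<Rightarrow> 'a \<Rightarrow> 'a \<Rightarrow> 'a" where
  "jquad jp v x = 2 *\<^sub>R jp v (jp v x) - jp (jp v v) x"

(* Applied to sets of the form M \<inter> jcone jp with M a subspace meeting jcone jp. *)
definition jdelta :: "('a::euclidean_space \<Rightarrow> 'a \<Rightarrow> 'a) \<Rightarrow> 'a \<Rightarrow> 'a set \<Rightarrow> real" where
  "jdelta jp e S =
     (GREATEST d. d \<in> {jdet jp e x | x. x \<in> S \<and> (jnorm_F jp e x)\<^sup>2 = real (jrank jp e)})"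

end

theory Submission
  imports Defs "HOL-Computational_Algebra.Polynomial" "HOL-Real_Asymp.Real_Asymp"
begin

text \<open>Let \<open>x\<close> maximize the determinant on the slice of \<open>L\<close> and put \<open>k = 2 a + a\<^sup>2\<close>. Since
  \<open>z - \<lambda> c\<close> lies in the closed cone for \<open>\<lambda> = \<parallel>z\<parallel>\<close>, the hypothesis on \<open>P\<^sub>L z\<close> gives
  \<open>\<langle>c, x\<rangle> \<le> \<epsilon> \<surd>r\<close>, whence \<open>\<langle>c, x\<^sup>2\<rangle> \<le> \<epsilon> r\<close>. The Peirce decomposition for \<open>c\<close> gives
  \<open>\<parallel>D\<^sub>v x\<parallel>\<^sup>2 = \<parallel>x\<parallel>\<^sup>2 + 2 k \<langle>c, x\<^sup>2\<rangle> + k\<^sup>2 \<langle>c, x\<rangle>\<^sup>2 \<le> r (1 + k \<epsilon>)\<^sup>2\<close>, while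
  \<open>det (D\<^sub>v x) \<ge> (1 + a)\<^sup>2 det x\<close>; it remains to rescale \<open>D\<^sub>v x\<close>. Only this inequality between
  determinants is needed, and it follows from the concavity of \<open>ln det\<close>: along the path
  \<open>s \<mapsto> D s x\<close> the logarithmic derivative is \<open>2 / s\<close>, and the tangent inequality is summed over
  small steps.\<close>

text \<open>Eigenvalues, trace and determinant are defined through an arbitrarily chosen spectral
  decomposition, so even linearity of the trace has to be earned. The axioms supply only some
  associative form. It is rescaled so that primitive idempotents get length 1; pairing with
  \<open>e\<close> is then the trace, and the form is the trace inner product. The determinant is
  never treated as a polynomial. Its independence of the frame, its boundedness and semicontinuity
  on a slice, and its growth along \<open>D s x\<close> all come from one tangent inequality for ln
  det, whose gradient at \<open>x\<close> is the inverse of \<open>x\<close>. The logarithmic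
  derivative is 2 / s because the derivative of \<open>D s x\<close> at \<open>s = 1\<close> is
  \<open>2 c x\<close>, which pairs with the inverse of \<open>x\<close> to 2 <e, c> = 2, and
  because \<open>D s\<close> composed with \<open>D t\<close> is \<open>D (s * t)\<close>, so every
  point of the path looks like its start.\<close>

context euclidean_jordan_algebra
begin

section \<open>Polarized Jordan identity and powers of one element\<close>

lemmas jp_simps =
  bilinear_ladd[OF bilinear] bilinear_radd[OF bilinear] bilinear_lmul[OF bilinear]
  bilinear_rmul[OF bilinear] bilinear_lzero[OF bilinear] bilinear_rzero[OF bilinear]
  bilinear_lneg[OF bilinear] bilinear_rneg[OF bilinear]
  bilinear_lsub[OF bilinear] bilinear_rsub[OF bilinear]

lemma jp_linear: "linear (jp x)"
  using bilinear by (simp add: bilinear_def)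

lemma jp_sum_right: "x \<odot> (\<Sum>i\<in>A. f i) = (\<Sum>i\<in>A. x \<odot> f i)"
  by (rule linear_sum[OF jp_linear])

lemma jp_sum_left: "(\<Sum>i\<in>A. f i) \<odot> x = (\<Sum>i\<in>A. f i \<odot> x)"
  by (simp add: commute[of _ x] jp_sum_right)

lemma unit_left: "e \<odot> x = x"
  using unit[of x] commute[of e x] by simp

text \<open>Polarization: the defect of the Jordan identity is cubic in \<open>x\<close>, so its
  alternating sum over the partial sums of \<open>x\<close>, \<open>y\<close>, \<open>z\<close>
  isolates the part linear in each of them, up to the factor 2.\<close>

lemma jordan_linearized:
  "x \<odot> ((y \<odot> z) \<odot> u) + y \<odot> ((x \<odot> z) \<odot> u) + z \<odot> ((x \<odot> y) \<odot> u)
   = (y \<odot> z) \<odot> (x \<odot> u) + (x \<odot> z) \<odot> (y \<odot> u) + (x \<odot> y) \<odot> (z \<odot> u)"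
proof -
  define f where "f x = x \<odot> ((x \<odot> x) \<odot> u) - (x \<odot> x) \<odot> (x \<odot> u)" for x
  have f0: "f x = 0" for x by (simp add: f_def jordan)
  have "f (x + y + z) - f (x + y) - f (x + z) - f (y + z) + f x + f y + f z = 0"
    by (simp add: f0)
  then have "2 *\<^sub>R (x \<odot> ((y \<odot> z) \<odot> u) + y \<odot> ((x \<odot> z) \<odot> u) + z \<odot> ((x \<odot> y) \<odot> u)
    - ((y \<odot> z) \<odot> (x \<odot> u) + (x \<odot> z) \<odot> (y \<odot> u) + (x \<odot> y) \<odot> (z \<odot> u))) = 0"
    unfolding f_def
    by (simp add: jp_simps scaleR_2 commute[of y x] commute[of z x] commute[of z y] algebra_simps)
  then show ?thesis by simp
qed

text \<open>The linearized Jordan identity, solved for multiplication by \<open>(y z) u\<close>: it expresses that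
  operator through multiplications by shorter products.\<close>

lemma jordan_operator:
  "((y \<odot> z) \<odot> u) \<odot> x = (y \<odot> z) \<odot> (u \<odot> x) + (y \<odot> u) \<odot> (z \<odot> x) + (z \<odot> u) \<odot> (y \<odot> x)
     - y \<odot> (u \<odot> (z \<odot> x)) - z \<odot> (u \<odot> (y \<odot> x))"
proof -
  have "x \<odot> ((y \<odot> z) \<odot> u) + y \<odot> ((x \<odot> z) \<odot> u) + z \<odot> ((x \<odot> y) \<odot> u)
   = (y \<odot> z) \<odot> (x \<odot> u) + (x \<odot> z) \<odot> (y \<odot> u) + (x \<odot> y) \<odot> (z \<odot> u)"
    by (rule jordan_linearized)
  then show ?thesis
    by (simp add: algebra_simps commute)
qed

text \<open>With \<open>y = u = x\<close> and \<open>z\<close> the n-th power,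
  \<open>jordan_operator\<close> writes multiplication by the power n + 2 through multiplications by
  \<open>x\<close>, its square and the powers n and n + 1. All of these commute with multiplication
  by \<open>x\<close>, hence the two-step induction.\<close>

lemma jpower_commute: "x \<odot> (jpower jp e x n \<odot> y) = jpower jp e x n \<odot> (x \<odot> y)"
proof (induction n arbitrary: y rule: induct_nat_012)
  case 0
  then show ?case by (simp add: unit_left)
next
  case 1
  then show ?case by (simp add: unit)
next
  case (ge2 n)
  let ?p = "jpower jp e x"
  have eq: "?p (Suc (Suc n)) \<odot> v = ?p (Suc n) \<odot> (x \<odot> v) + (x \<odot> x) \<odot> (?p n \<odot> v)
      + ?p (Suc n) \<odot> (x \<odot> v) - x \<odot> (x \<odot> (?p n \<odot> v)) - ?p n \<odot> (x \<odot> (x \<odot> v))" for v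
    using jordan_operator[of x "?p n" x v] commute[of "?p n" x] commute[of "x \<odot> ?p n" x] by simp
  show ?case unfolding eq jp_simps
    using ge2 jordan[of x] by simp
qed

lemma jpower_add: "jpower jp e x m \<odot> jpower jp e x n = jpower jp e x (m + n)"
  by (induction n) (simp_all add: unit jpower_commute[symmetric])

text \<open>The power 0 is left out: if an idempotent \<open>f\<close> fixes \<open>x\<close>, it
  fixes this whole span, whereas it would send \<open>e\<close> to \<open>f\<close>.\<close>

definition posi_powers :: "'a \<Rightarrow> 'a set"
  where "posi_powers x = span (range (\<lambda>n. jpower jp e x (Suc n)))"

lemma posi_powers_mult:
  assumes "v \<in> posi_powers x"
  shows "x \<odot> v \<in> posi_powers x"
  using assms unfolding posi_powers_def
proof (induction rule: span_induct_alt)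
  case base
  then show ?case by (simp add: jp_simps span_zero)
next
  case (step c v y)
  then obtain n where "v = jpower jp e x (Suc n)" by auto
  then have "x \<odot> v = jpower jp e x (Suc (Suc n))" by simp
  then have "x \<odot> v \<in> span (range (\<lambda>n. jpower jp e x (Suc n)))"
    by (simp only:) (rule span_base, blast)
  then show ?case using step by (simp add: jp_simps span_add span_scale)
qed

lemma jpower_eigen:
  assumes "v \<in> posi_powers x" "x \<odot> v = l *\<^sub>R v"
  shows "jpower jp e x n \<odot> v = l ^ n *\<^sub>R v"
proof (induction n)
  case 0
  then show ?case by (simp add: unit_left)
next
  case (Suc n)
  \<comment> \<open>Multiplication is not associative in general; on the span of the powers of
    \<open>x\<close> this instance of associativity follows from \<open>jpower_add\<close>.\<close>
  have "jpower jp e x (Suc n) \<odot> w = x \<odot> (jpower jp e x n \<odot> w)" if "w \<in> posi_powers x" for w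
    using that unfolding posi_powers_def
  proof (induction rule: span_induct_alt)
    case base
    then show ?case by (simp add: jp_simps)
  next
    case (step c w y)
    then obtain m where "w = jpower jp e x (Suc m)" by auto
    then have "jpower jp e x (Suc n) \<odot> w = x \<odot> (jpower jp e x n \<odot> w)"
      by (simp only: jpower_add) simp
    then show ?case using step by (simp add: jp_simps)
  qed
  with Suc assms show ?case by (simp add: jp_simps)
qed

text \<open>Intended for \<open>u = v\<close>: an eigenvector inside the span squares to a multiple
  of itself, so it is an idempotent up to scaling.\<close>

lemma posi_powers_eigen:
  assumes "v \<in> posi_powers x" "x \<odot> v = l *\<^sub>R v" "u \<in> posi_powers x"
  obtains g where "u \<odot> v = g *\<^sub>R v"
proof -
  have "\<exists>g. u \<odot> v = g *\<^sub>R v"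
    using assms(3) unfolding posi_powers_def
  proof (induction rule: span_induct_alt)
    case base
    then show ?case by (metis jp_simps(5) scaleR_zero_left)
  next
    case (step k w y)
    then obtain n g where w: "w = jpower jp e x (Suc n)" and g: "y \<odot> v = g *\<^sub>R v" by auto
    have "(k *\<^sub>R w + y) \<odot> v = (k * l ^ Suc n + g) *\<^sub>R v"
      by (simp only: jp_simps w jpower_eigen[OF assms(1,2)] g) (simp add: algebra_simps)
    then show ?case by blast
  qed
  then show ?thesis using that by blast
qed

lemma posi_powers_self: "x \<in> posi_powers x"
proof -
  have "x = jpower jp e x (Suc 0)" by (simp add: unit)
  then show ?thesis unfolding posi_powers_def by (metis rangeI span_base)
qed

subsection \<open>The Peirce decomposition\<close>

context
  fixes c
  assumes idem: "c \<odot> c = c"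
begin

text \<open>Multiplication by \<open>c\<close> is a root of 2 t^3 - 3 t^2 + t = t (2 t - 1) (t - 1),
  so its only possible eigenvalues are 0, 1/2 and 1.\<close>

lemma peirce_cubic: "2 *\<^sub>R (c \<odot> (c \<odot> (c \<odot> x))) = 3 *\<^sub>R (c \<odot> (c \<odot> x)) - c \<odot> x"
proof -
  have "c \<odot> x = c \<odot> (c \<odot> x) + c \<odot> (c \<odot> x) + c \<odot> (c \<odot> x)
      - c \<odot> (c \<odot> (c \<odot> x)) - c \<odot> (c \<odot> (c \<odot> x))"
    using jordan_operator[of c c c x] by (simp add: idem)
  moreover have "3 *\<^sub>R y = y + y + y" for y :: 'a
    by (metis (no_types) numeral_plus_one scaleR_2 scaleR_left_distrib scaleR_one semiring_norm(5))
  ultimately show ?thesis by (simp add: scaleR_2 algebra_simps)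
qed

lemma peirce_one_part: "c \<odot> (2 *\<^sub>R (c \<odot> (c \<odot> x)) - c \<odot> x) = 2 *\<^sub>R (c \<odot> (c \<odot> x)) - c \<odot> x"
proof -
  have "c \<odot> (2 *\<^sub>R (c \<odot> (c \<odot> x)) - c \<odot> x) = 2 *\<^sub>R (c \<odot> (c \<odot> (c \<odot> x))) - c \<odot> (c \<odot> x)"
    by (simp add: jp_simps)
  also have "\<dots> = (3 - 1) *\<^sub>R (c \<odot> (c \<odot> x)) - c \<odot> x"
    unfolding peirce_cubic by (simp only: scaleR_left_diff_distrib) simp
  finally show ?thesis by simp
qed

text \<open>The witnesses are the Lagrange polynomials for the nodes 1, 1/2, 0, namely 2 t^2 - t, 4
  t - 4 t^2 and 1 - 3 t + 2 t^2, evaluated at multiplication by \<open>c\<close>.\<close>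

lemma peirce_decomp:
  obtains x1 xh x0 where "x = x1 + xh + x0" "c \<odot> x1 = x1" "c \<odot> xh = (1/2) *\<^sub>R xh" "c \<odot> x0 = 0"
proof
  let ?A = "c \<odot> x" and ?B = "c \<odot> (c \<odot> x)"
  have cub: "c \<odot> (c \<odot> (c \<odot> x)) = (3/2) *\<^sub>R ?B - (1/2) *\<^sub>R ?A"
  proof -
    have "c \<odot> (c \<odot> (c \<odot> x)) = (1/2) *\<^sub>R (2 *\<^sub>R (c \<odot> (c \<odot> (c \<odot> x))))" by simp
    then show ?thesis unfolding peirce_cubic by (simp add: scaleR_right_diff_distrib)
  qed
  show "c \<odot> (2 *\<^sub>R ?B - ?A) = 2 *\<^sub>R ?B - ?A" by (rule peirce_one_part)
  show "c \<odot> (4 *\<^sub>R ?A - 4 *\<^sub>R ?B) = (1/2) *\<^sub>R (4 *\<^sub>R ?A - 4 *\<^sub>R ?B)"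
    unfolding jp_simps cub
    by (rule euclidean_eqI) (simp add: algebra_simps)
  show "c \<odot> (x - 3 *\<^sub>R ?A + 2 *\<^sub>R ?B) = 0"
    unfolding jp_simps cub
    by (rule euclidean_eqI) (simp add: algebra_simps)
  show "x = (2 *\<^sub>R ?B - ?A) + (4 *\<^sub>R ?A - 4 *\<^sub>R ?B) + (x - 3 *\<^sub>R ?A + 2 *\<^sub>R ?B)"
    by (rule euclidean_eqI) (simp add: algebra_simps)
qed

text \<open>The polarized identity with \<open>c\<close> in two places says that 2 m - 1 times the
  commutator of the two multiplications vanishes. The multiplication rules for the eigenspaces 0 and
  1 are consequences.\<close>

lemma peirce_commute:
  assumes "c \<odot> z = m *\<^sub>R z" "m \<noteq> 1/2"
  shows "c \<odot> (z \<odot> y) = z \<odot> (c \<odot> y)"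
proof -
  have "c \<odot> ((c \<odot> z) \<odot> y) + c \<odot> ((c \<odot> z) \<odot> y) + z \<odot> (c \<odot> y)
      = (c \<odot> z) \<odot> (c \<odot> y) + (c \<odot> z) \<odot> (c \<odot> y) + c \<odot> (z \<odot> y)"
    using jordan_linearized[of c c z y] by (simp add: idem)
  then have "m *\<^sub>R (c \<odot> (z \<odot> y)) + m *\<^sub>R (c \<odot> (z \<odot> y)) + z \<odot> (c \<odot> y)
      = m *\<^sub>R (z \<odot> (c \<odot> y)) + m *\<^sub>R (z \<odot> (c \<odot> y)) + c \<odot> (z \<odot> y)"
    by (simp only: assms(1) jp_simps)
  moreover have "(m + m - 1) *\<^sub>R (c \<odot> (z \<odot> y) - z \<odot> (c \<odot> y))
      = (m *\<^sub>R (c \<odot> (z \<odot> y)) + m *\<^sub>R (c \<odot> (z \<odot> y)) + z \<odot> (c \<odot> y))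
        - (m *\<^sub>R (z \<odot> (c \<odot> y)) + m *\<^sub>R (z \<odot> (c \<odot> y)) + c \<odot> (z \<odot> y))"
    by (rule euclidean_eqI) (simp add: algebra_simps)
  ultimately have "(m + m - 1) *\<^sub>R (c \<odot> (z \<odot> y) - z \<odot> (c \<odot> y)) = 0"
    by simp
  with assms(2) show ?thesis by simp
qed

lemma peirce_11:
  assumes "c \<odot> x = x" "c \<odot> y = y"
  shows "c \<odot> (x \<odot> y) = x \<odot> y"
  using peirce_commute[of x 1 y] assms by simp

lemma peirce_00:
  assumes "c \<odot> x = 0" "c \<odot> y = 0"
  shows "c \<odot> (x \<odot> y) = 0"
  using peirce_commute[of x 0 y] assms by (simp add: jp_simps)

lemma peirce_10:
  assumes "c \<odot> x = x" "c \<odot> y = 0"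
  shows "x \<odot> y = 0"
  using peirce_commute[of x 1 y] peirce_commute[of y 0 x] assms
  by (simp add: jp_simps commute)

lemma peirce_0h:
  assumes "c \<odot> x = 0" "c \<odot> y = (1/2) *\<^sub>R y"
  shows "c \<odot> (x \<odot> y) = (1/2) *\<^sub>R (x \<odot> y)"
  using peirce_commute[of x 0 y] assms by (simp add: jp_simps)

text \<open>The conclusion excludes a component of the product for the eigenvalue 1/2, since t^2 = t
  fails there.\<close>

lemma peirce_hh:
  assumes "c \<odot> x = (1/2) *\<^sub>R x" "c \<odot> y = (1/2) *\<^sub>R y"
  shows "c \<odot> (c \<odot> (x \<odot> y)) = c \<odot> (x \<odot> y)"
proof -
  have "x \<odot> ((c \<odot> y) \<odot> c) + c \<odot> ((x \<odot> y) \<odot> c) + y \<odot> ((x \<odot> c) \<odot> c)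
   = (c \<odot> y) \<odot> (x \<odot> c) + (x \<odot> y) \<odot> (c \<odot> c) + (x \<odot> c) \<odot> (y \<odot> c)"
    by (rule jordan_linearized)
  then show ?thesis
    by (simp add: idem commute[of x c] commute[of y c] commute[of "x \<odot> y" c] assms jp_simps commute[of y x])
qed

lemma peirce_unique:
  assumes "x1 + xh + x0 = y1 + yh + y0"
    and "c \<odot> x1 = x1" "c \<odot> xh = (1/2) *\<^sub>R xh" "c \<odot> x0 = 0"
    and "c \<odot> y1 = y1" "c \<odot> yh = (1/2) *\<^sub>R yh" "c \<odot> y0 = 0"
  shows "x1 = y1" "xh = yh" "x0 = y0"
proof -
  let ?a = "x1 - y1" and ?b = "xh - yh" and ?d = "x0 - y0"
  have s: "?a + ?b + ?d = 0" using assms(1) by (simp add: algebra_simps)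
  have "c \<odot> (?a + ?b + ?d) = ?a + (1/2) *\<^sub>R ?b"
    by (simp only: jp_simps assms(2-)) (simp add: algebra_simps)
  with s have s2: "?a + (1/2) *\<^sub>R ?b = 0" by (simp add: jp_simps)
  have "c \<odot> (?a + (1/2) *\<^sub>R ?b) = ?a + (1/4) *\<^sub>R ?b"
    by (simp only: jp_simps assms(2-)) (simp add: algebra_simps)
  with s2 have s3: "?a + (1/4) *\<^sub>R ?b = 0" by (simp add: jp_simps)
  have "(1/2 - 1/4) *\<^sub>R ?b = 0" using s2 s3 unfolding scaleR_left_diff_distrib
    by (metis add_left_cancel diff_self)
  then have b: "?b = 0" by simp
  with s2 have a: "?a = 0" by simp
  from a b s have "?d = 0" by simp
  with a b show "x1 = y1" "xh = yh" "x0 = y0" by simp_all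
qed

end

end

section \<open>Associative positive definite forms and eigenvectors\<close>

locale jordan_form = euclidean_jordan_algebra jp e
  for jp :: "'a::euclidean_space \<Rightarrow> 'a \<Rightarrow> 'a" (infixl "\<odot>" 70) and e :: 'a +
  fixes B :: "'a \<Rightarrow> 'a \<Rightarrow> real"
  assumes B_bilinear: "bilinear B"
    and B_assoc: "B (x \<odot> y) z = B x (y \<odot> z)"
    and B_pos: "x \<noteq> 0 \<Longrightarrow> B x x > 0"
begin

lemmas B_simps =
  bilinear_ladd[OF B_bilinear] bilinear_radd[OF B_bilinear] bilinear_lmul[OF B_bilinear]
  bilinear_rmul[OF B_bilinear] bilinear_lzero[OF B_bilinear] bilinear_rzero[OF B_bilinear]
  bilinear_lneg[OF B_bilinear] bilinear_rneg[OF B_bilinear]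
  bilinear_lsub[OF B_bilinear] bilinear_rsub[OF B_bilinear]

lemma B_linear: "linear (B x)"
  using B_bilinear by (simp add: bilinear_def)

lemma B_unit: "B e (x \<odot> y) = B x y"
  by (metis B_assoc unit_left)

lemma B_sym: "B x y = B y x"
  by (metis B_unit commute)

lemma B_assoc_left: "B (x \<odot> y) z = B y (x \<odot> z)"
  by (metis B_assoc commute)

lemma B_sum_right: "B x (\<Sum>i\<in>A. f i) = (\<Sum>i\<in>A. B x (f i))"
  by (rule linear_sum[OF B_linear])

lemma B_sum_left: "B (\<Sum>i\<in>A. f i) x = (\<Sum>i\<in>A. B (f i) x)"
  by (simp add: B_sym[of _ x] B_sum_right)

lemma B_nonneg: "B x x \<ge> 0"
  by (cases "x = 0") (simp_all add: B_simps B_pos less_imp_le)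

lemma B_eq_0: "B x x = 0 \<longleftrightarrow> x = 0"
  using B_pos[of x] by (cases "x = 0") (simp_all add: B_simps)

lemma continuous_on_B:
  assumes "continuous_on S f" "continuous_on S g"
  shows "continuous_on S (\<lambda>x. B (f x) (g x))"
  using bounded_bilinear.continuous_on[OF _ assms] B_bilinear
  by (simp add: bilinear_conv_bounded_bilinear)

lemma B_Cauchy_Schwarz: "\<bar>B x y\<bar> \<le> sqrt (B x x) * sqrt (B y y)"
proof (cases "y = 0")
  case True
  then show ?thesis by (simp add: B_simps)
next
  case False
  then have y: "B y y > 0" by (rule B_pos)
  let ?t = "B x y / B y y"
  have "0 \<le> B (x - ?t *\<^sub>R y) (x - ?t *\<^sub>R y)" by (rule B_nonneg)
  also have "\<dots> = B x x - (B x y)\<^sup>2 / B y y"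
    using y by (simp add: B_simps B_sym[of y x] power2_eq_square field_simps)
  finally have "(B x y)\<^sup>2 \<le> B x x * B y y" using y by (simp add: field_simps)
  then show ?thesis
    by (metis real_sqrt_abs real_sqrt_le_mono real_sqrt_mult)
qed

lemma B_eigen_orthogonal:
  assumes "c \<odot> x = m *\<^sub>R x" "c \<odot> y = n *\<^sub>R y" "m \<noteq> n"
  shows "B x y = 0"
proof -
  have "B (c \<odot> x) y = B x (c \<odot> y)" by (rule B_assoc_left)
  with assms show ?thesis by (simp add: B_simps)
qed

text \<open>By associativity the value is \<open>B y (c \<odot> y)\<close>, and multiplication by
  \<open>c\<close> is self-adjoint with eigenvalues 0, 1/2, 1.\<close>

lemma B_idempotent_square:
  assumes "c \<odot> c = c"
  shows "B (y \<odot> y) c \<ge> 0"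
proof -
  obtain y1 yh y0 where y: "y = y1 + yh + y0" "c \<odot> y1 = y1" "c \<odot> yh = (1/2) *\<^sub>R yh" "c \<odot> y0 = 0"
    using peirce_decomp[OF assms] .
  have o: "B y1 yh = 0" "B yh y1 = 0" "B y1 y0 = 0" "B yh y0 = 0"
    using B_eigen_orthogonal[of c y1 1 yh "1/2"] B_eigen_orthogonal[of c yh "1/2" y1 1]
      B_eigen_orthogonal[of c y1 1 y0 0] B_eigen_orthogonal[of c yh "1/2" y0 0] y by simp_all
  have "B (y \<odot> y) c = B y (c \<odot> y)" by (simp add: B_assoc commute)
  also have "\<dots> = B (y1 + yh + y0) (y1 + (1/2) *\<^sub>R yh)"
    using y by (simp add: jp_simps)
  also have "\<dots> = B y1 y1 + B yh yh / 2"
    using o by (simp add: B_simps B_sym)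
  finally show ?thesis using B_nonneg[of y1] B_nonneg[of yh] by simp
qed

text \<open>A maximizer \<open>u\<close> of the Rayleigh quotient is an eigenvector: the form
  \<open>G\<close> of \<open>l\<close> minus multiplication by \<open>x\<close> is positive
  semidefinite on \<open>A\<close> and vanishes at \<open>u\<close>, so \<open>u\<close> lies in its
  radical. Pairing \<open>u\<close> with its own defect \<open>l u - x u\<close> shows that the
  defect has length 0.\<close>

lemma eigenvector_in_invariant:
  assumes A: "subspace A" "\<And>v. v \<in> A \<Longrightarrow> x \<odot> v \<in> A" and w: "w \<in> A" "w \<noteq> 0"
  obtains u l where "u \<in> A" "u \<noteq> 0" "x \<odot> u = l *\<^sub>R u"
proof -
  let ?S = "sphere 0 1 \<inter> A"
  let ?q = "\<lambda>u. B (x \<odot> u) u / B u u"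
  have "compact ?S" by (simp add: A closed_subspace compact_Int_closed)
  moreover have "(1 / norm w) *\<^sub>R w \<in> ?S" using w A by (simp add: subspace_scale)
  moreover have "continuous_on ?S ?q"
  proof (intro continuous_on_divide continuous_on_B continuous_on_id linear_continuous_on)
    show "bounded_linear ((\<odot>) x)" using jp_linear by (simp add: linear_conv_bounded_linear)
    show "\<forall>u\<in>?S. B u u \<noteq> 0" by (auto simp: B_eq_0)
  qed
  ultimately obtain u where u: "u \<in> ?S" and max: "\<And>v. v \<in> ?S \<Longrightarrow> ?q v \<le> ?q u"
    using continuous_attains_sup[of ?S ?q] by blast
  have u0: "u \<noteq> 0" "u \<in> A" using u by auto
  define l where "l = ?q u"
  define G where "G v w = l * B v w - B (x \<odot> v) w" for v w
  have G_nonneg: "G v v \<ge> 0" if v: "v \<in> A" for v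
  proof (cases "v = 0")
    case True
    then show ?thesis by (simp add: G_def B_simps jp_simps)
  next
    case False
    have "?q ((1 / norm v) *\<^sub>R v) \<le> l"
      unfolding l_def using v False A by (intro max) (simp add: subspace_scale)
    moreover have "?q ((1 / norm v) *\<^sub>R v) = ?q v"
      using False by (simp add: B_simps jp_simps)
    ultimately show ?thesis using B_pos[OF False] by (simp add: G_def divide_le_eq)
  qed
  have Guu: "G u u = 0" using B_pos[OF u0(1)] by (simp add: G_def l_def)
  have G_sym: "G v w = G w v" for v w
    by (simp add: G_def B_sym[of v w] B_sym[of "x \<odot> v" w]) (metis B_assoc_left)
  have G_zero: "G u v = 0" if v: "v \<in> A" for v
  proof (rule ccontr)
    assume ne: "G u v \<noteq> 0"
    have quad: "0 \<le> 2 * t * G u v + t\<^sup>2 * G v v" for t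
    proof -
      have "0 \<le> G (u + t *\<^sub>R v) (u + t *\<^sub>R v)"
        using A v u0 by (intro G_nonneg) (simp add: subspace_add subspace_scale)
      also have "\<dots> = G u u + t * G u v + t * G v u + t\<^sup>2 * G v v"
        by (simp add: G_def B_simps jp_simps algebra_simps power2_eq_square)
      finally show ?thesis using Guu G_sym[of v u] by simp
    qed
    \<comment> \<open>The summand 1 makes \<open>q\<close> positive even if
      \<open>G v v = 0\<close>; \<open>t\<close> is the minimizer of the quadratic with
      \<open>q\<close> in place of \<open>G v v\<close>.\<close>
    define q where "q = G v v + 1"
    define t where "t = - G u v / q"
    have p: "q > 0" using G_nonneg[OF v] by (simp add: q_def)
    have "2 * t * G u v + t\<^sup>2 * G v v < 2 * t * G u v + t\<^sup>2 * q"
      using ne p by (simp add: t_def q_def)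
    also have "\<dots> = - (G u v)\<^sup>2 / q"
      using p by (simp add: t_def power2_eq_square field_simps)
    also have "\<dots> \<le> 0" using p by simp
    finally show False using quad[of t] by simp
  qed
  let ?d = "l *\<^sub>R u - x \<odot> u"
  have "?d \<in> A" using A u0 by (simp add: subspace_diff subspace_scale)
  then have "G u ?d = 0" by (rule G_zero)
  moreover have "B ?d ?d = G u ?d" unfolding G_def by (simp only: B_simps(3,9) real_scaleR_def)
  ultimately have "B ?d ?d = 0" by simp
  then have "x \<odot> u = l *\<^sub>R u" by (simp add: B_eq_0)
  with u0 that show ?thesis by blast
qed

text \<open>An eigenvector \<open>u\<close> of \<open>x\<close> in the span satisfies
  \<open>u \<odot> u = g u\<close>. Here \<open>g\<close> is not 0 because
  \<open>B u u = B e (u \<odot> u)\<close>, so \<open>u / g\<close> is idempotent.\<close>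

lemma idempotent_in_powers:
  assumes "x \<noteq> 0"
  obtains p l where "p \<in> posi_powers x" "p \<odot> p = p" "p \<noteq> 0" "x \<odot> p = l *\<^sub>R p"
proof -
  have sub: "subspace (posi_powers x)" unfolding posi_powers_def by (rule subspace_span)
  obtain u l where u: "u \<in> posi_powers x" "u \<noteq> 0" "x \<odot> u = l *\<^sub>R u"
    using eigenvector_in_invariant[OF sub posi_powers_mult posi_powers_self assms] .
  obtain g where g: "u \<odot> u = g *\<^sub>R u" using posi_powers_eigen[OF u(1,3,1)] .
  have "g \<noteq> 0"
  proof
    assume "g = 0"
    then have "B u u = 0" using B_unit[of u u] g by (simp add: B_simps)
    with u show False by (simp add: B_eq_0)
  qed
  show ?thesis
  proof (rule that)
    show "(1/g) *\<^sub>R u \<in> posi_powers x" using sub u by (simp add: subspace_scale)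
    show "(1/g) *\<^sub>R u \<odot> (1/g) *\<^sub>R u = (1/g) *\<^sub>R u" using g \<open>g \<noteq> 0\<close> by (simp add: jp_simps)
    show "(1/g) *\<^sub>R u \<noteq> 0" using u \<open>g \<noteq> 0\<close> by simp
    show "x \<odot> (1/g) *\<^sub>R u = l *\<^sub>R (1/g) *\<^sub>R u" using u by (simp add: jp_simps)
  qed
qed

lemma posi_powers_peirce_1:
  assumes f: "f \<odot> f = f" "f \<odot> x = x" and p: "p \<in> posi_powers x"
  shows "f \<odot> p = p"
  using p unfolding posi_powers_def
proof (induction rule: span_induct_alt)
  case base
  then show ?case by (simp add: jp_simps)
next
  case (step c v y)
  have "f \<odot> jpower jp e x (Suc n) = jpower jp e x (Suc n)" for n
  proof (induction n)
    case 0
    then show ?case using f by (simp add: unit)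
  next
    case (Suc n)
    then show ?case using peirce_11[OF f(1,2), of "jpower jp e x (Suc n)"] by simp
  qed
  with step show ?case by (auto simp: jp_simps simp del: jpower.simps)
qed

section \<open>Primitive idempotents and the spectral theorem\<close>

abbreviation prim :: "'a \<Rightarrow> bool" where "prim \<equiv> primitive_idempotent jp"

lemma prim_idem: "prim c \<Longrightarrow> c \<odot> c = c"
  by (simp add: primitive_idempotent_def jidempotent_def)

lemma prim_nonzero: "prim c \<Longrightarrow> c \<noteq> 0"
  by (simp add: primitive_idempotent_def)

lemma idempotent_complement:
  assumes "f \<odot> f = f" "p \<odot> p = p" "f \<odot> p = p"
  shows "(f - p) \<odot> (f - p) = f - p"
  using assms commute[of p f] by (simp add: jp_simps)

text \<open>For \<open>x\<close> other than 0, an idempotent in the span of its powers lies in the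
  1-space of \<open>c\<close>, so it splits \<open>c\<close> unless it equals \<open>c\<close>.
  Being an eigenvector of \<open>x\<close>, it then makes \<open>x\<close> a multiple of
  \<open>c\<close>.\<close>

lemma prim_peirce_1:
  assumes c: "prim c" and x: "c \<odot> x = x"
  obtains l where "x = l *\<^sub>R c"
proof (cases "x = 0")
  case True
  then show ?thesis using that[of 0] by simp
next
  case False
  obtain p l where p: "p \<in> posi_powers x" "p \<odot> p = p" "p \<noteq> 0" "x \<odot> p = l *\<^sub>R p"
    using idempotent_in_powers[OF False] .
  have cp: "c \<odot> p = p" using posi_powers_peirce_1[OF prim_idem[OF c] x p(1)] .
  have "jidempotent jp (c - p)"
    using idempotent_complement[OF prim_idem[OF c] p(2) cp] by (simp add: jidempotent_def)
  then have "p = c"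
    using c p unfolding primitive_idempotent_def
    by (metis add_diff_cancel_left' diff_add_cancel jidempotent_def right_minus_eq add.commute)
  then show ?thesis using p x that[of l] by (simp add: commute)
qed

text \<open>A Jordan frame as a set, with its cardinality left open and with any sum
  \<open>f\<close> in place of \<open>e\<close>; the spectral theorem is proved by splitting
  \<open>f\<close>, before the rank is known.\<close>

definition ortho_system :: "'a set \<Rightarrow> 'a \<Rightarrow> bool" where
  "ortho_system F f \<longleftrightarrow> finite F \<and> (\<forall>c\<in>F. prim c) \<and> (\<forall>c\<in>F. \<forall>d\<in>F. c \<noteq> d \<longrightarrow> c \<odot> d = 0) \<and> \<Sum>F = f"

lemma ortho_system_mult:
  assumes "ortho_system F f" "c \<in> F"
  shows "(\<Sum>d\<in>F. l d *\<^sub>R d) \<odot> c = l c *\<^sub>R c"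
proof -
  have "(\<Sum>d\<in>F. l d *\<^sub>R d) \<odot> c = (\<Sum>d\<in>F. if d = c then l c *\<^sub>R c else 0)"
    unfolding jp_sum_left using assms
    by (intro sum.cong) (auto simp: jp_simps ortho_system_def prim_idem)
  then show ?thesis using assms by (simp add: ortho_system_def)
qed

lemma ortho_system_unit:
  assumes "ortho_system F f" "c \<in> F"
  shows "f \<odot> c = c"
  using ortho_system_mult[OF assms, of "\<lambda>_. 1"] assms by (simp add: ortho_system_def)

lemma ortho_system_union:
  assumes F: "ortho_system F p" and G: "ortho_system G q"
    and pq: "p \<odot> p = p" "q \<odot> q = q" "p \<odot> q = 0"
  shows "ortho_system (F \<union> G) (p + q)" "F \<inter> G = {}"
proof -
  have z: "c \<odot> d = 0" if "c \<in> F" "d \<in> G" for c d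
  proof -
    have "d \<odot> p = 0"
      using peirce_10[OF pq(2) ortho_system_unit[OF G that(2)], of p] pq(3) by (simp add: commute)
    then show ?thesis
      using peirce_10[OF pq(1) ortho_system_unit[OF F that(1)], of d] by (simp add: commute)
  qed
  show dis: "F \<inter> G = {}"
  proof (rule ccontr)
    assume "F \<inter> G \<noteq> {}"
    then obtain c where c: "c \<in> F" "c \<in> G" by blast
    then have "prim c" using F by (simp add: ortho_system_def)
    then show False using z[OF c] prim_idem[of c] prim_nonzero[of c] by simp
  qed
  have "d \<odot> c = 0" if "c \<in> F" "d \<in> G" for c d
    using z[OF that] by (simp add: commute)
  with z dis F G show "ortho_system (F \<union> G) (p + q)"
    unfolding ortho_system_def by (auto simp: sum.union_disjoint)
qed

text \<open>Induction on the dimension of the 1-space of \<open>f\<close>. If \<open>x\<close> is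
  not a multiple of \<open>f\<close>, an idempotent from the powers of \<open>x\<close> splits both
  \<open>f\<close> and \<open>x\<close>; if it is a multiple, a splitting of a non-primitive
  \<open>f\<close> serves.\<close>

lemma spectral_peirce:
  assumes "f \<odot> f = f" "f \<odot> x = x"
  shows "\<exists>F l. ortho_system F f \<and> x = (\<Sum>c\<in>F. l c *\<^sub>R c)"
  using assms
proof (induction "dim {y. f \<odot> y = y}" arbitrary: f x rule: less_induct)
  case less
  note f = less.prems(1) and x = less.prems(2)
  have sub: "subspace {y. g \<odot> y = y}" for g
    by (auto simp: subspace_def jp_simps)
  have split: ?case
    if p: "p \<odot> p = p" "f \<odot> p = p" "p \<noteq> 0" "p \<noteq> f"
      and x12: "x = x1 + x2" "p \<odot> x1 = x1" "(f - p) \<odot> x2 = x2" for p x1 x2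
  proof -
    let ?q = "f - p"
    have q: "?q \<odot> ?q = ?q" using idempotent_complement[OF f p(1,2)] .
    have pq: "p \<odot> ?q = 0" using p by (simp add: jp_simps commute)
    have dim_less: "dim {y. g \<odot> y = y} < dim {y. f \<odot> y = y}"
      if g: "g \<odot> g = g" "h \<odot> g = 0" "h \<odot> h = h" "h \<noteq> 0" "f = g + h" for g h
    proof (rule dim_psubset)
      have "{y. g \<odot> y = y} \<subseteq> {y. f \<odot> y = y}"
      proof safe
        fix y assume y: "g \<odot> y = y"
        have "y \<odot> h = 0" using peirce_10[OF g(1) y] g(2) by (simp add: commute)
        then show "f \<odot> y = y" using g y by (simp add: jp_simps commute)
      qed
      \<comment> \<open>The idempotent \<open>f\<close> itself witnesses strictness: it is sent to
        \<open>g\<close>, not to \<open>f\<close>, by multiplication with \<open>g\<close>.\<close>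
      moreover have "f \<in> {y. f \<odot> y = y}" "f \<notin> {y. g \<odot> y = y}"
        using g f by (auto simp: jp_simps commute)
      ultimately have "{y. g \<odot> y = y} \<subset> {y. f \<odot> y = y}" by blast
      then show "span {y. g \<odot> y = y} \<subset> span {y. f \<odot> y = y}"
        using sub by (simp add: span_eq_iff[THEN iffD2])
    qed
    obtain F l where F: "ortho_system F p" "x1 = (\<Sum>c\<in>F. l c *\<^sub>R c)"
      using less.hyps[OF dim_less[of p ?q] p(1) x12(2)] p q pq by (auto simp: commute)
    obtain G k where G: "ortho_system G ?q" "x2 = (\<Sum>c\<in>G. k c *\<^sub>R c)"
      using less.hyps[OF dim_less[of ?q p] q x12(3)] p q pq by (auto simp: commute)
    note U = ortho_system_union[OF F(1) G(1) p(1) q pq]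
    let ?l = "\<lambda>c. if c \<in> F then l c else k c"
    have "(\<Sum>c\<in>F \<union> G. ?l c *\<^sub>R c) = (\<Sum>c\<in>F. ?l c *\<^sub>R c) + (\<Sum>c\<in>G. ?l c *\<^sub>R c)"
      using F G U by (intro sum.union_disjoint) (auto simp: ortho_system_def)
    also have "(\<Sum>c\<in>F. ?l c *\<^sub>R c) = x1" using F by simp
    also have "(\<Sum>c\<in>G. ?l c *\<^sub>R c) = x2"
      unfolding G(2) using U(2) by (intro sum.cong) auto
    finally have "x = (\<Sum>c\<in>F \<union> G. ?l c *\<^sub>R c)" using x12 by simp
    moreover have "ortho_system (F \<union> G) f" using U(1) by simp
    ultimately show ?thesis by (intro exI conjI)
  qed
  show ?case
  proof (cases "f = 0")
    case True
    then have "x = 0" using x by (simp add: jp_simps)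
    with True show ?thesis by (intro exI[of _ "{}"]) (simp add: ortho_system_def)
  next
    case f0: False
    show ?thesis
    proof (cases "\<exists>l. x = l *\<^sub>R f")
      case True
      then obtain l where l: "x = l *\<^sub>R f" by blast
      show ?thesis
      proof (cases "prim f")
        case True
        then have "ortho_system {f} f" by (simp add: ortho_system_def)
        then show ?thesis using l by (intro exI[of _ "{f}"] exI[of _ "\<lambda>_. l"]) simp
      next
        case False
        then obtain p q where pq: "p \<odot> p = p" "q \<odot> q = q" "p \<noteq> 0" "q \<noteq> 0" "f = p + q"
          using f f0 by (auto simp: primitive_idempotent_def jidempotent_def)
        have "(p + q) \<odot> (p + q) = p + q" using f pq by simp
        then have "2 *\<^sub>R (p \<odot> q) = 0"
          using pq by (simp add: jp_simps commute[of q p] scaleR_2 algebra_simps)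
        then have "p \<odot> q = 0" by simp
        then show ?thesis
          using split[of p "l *\<^sub>R p" "l *\<^sub>R q"] pq l
          by (simp add: jp_simps scaleR_right_distrib commute[of q p])
      qed
    next
      case False
      then have "x \<noteq> 0" by (metis scaleR_zero_left)
      then obtain p l where p: "p \<in> posi_powers x" "p \<odot> p = p" "p \<noteq> 0" "x \<odot> p = l *\<^sub>R p"
        using idempotent_in_powers by blast
      have fp: "f \<odot> p = p" using posi_powers_peirce_1[OF f x p(1)] .
      have "p \<noteq> f" using False p(4) x by (metis commute)
      moreover have "(f - p) \<odot> (x - l *\<^sub>R p) = x - l *\<^sub>R p"
        using p fp x by (simp add: jp_simps commute[of p x])
      ultimately show ?thesis
        using split[of p "l *\<^sub>R p" "x - l *\<^sub>R p"] p fp by (simp add: jp_simps)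
    qed
  qed
qed

lemma spectral:
  obtains F l where "ortho_system F e" "x = (\<Sum>c\<in>F. l c *\<^sub>R c)"
  using spectral_peirce[of e x] by (auto simp: unit_left)

text \<open>Comparing the Peirce components of \<open>d \<odot> d = d\<close> with respect to
  \<open>c\<close> leaves one unknown, the 0-component of \<open>u \<odot> u\<close>. It is found by
  exchanging roles: the 1-component of \<open>c\<close> with respect to \<open>d\<close> must be a
  multiple of \<open>d\<close>.\<close>

lemma prim_pair:
  assumes c: "prim c" and d: "prim d"
  obtains l u w where "d = l *\<^sub>R c + u + w" "c \<odot> u = (1/2) *\<^sub>R u" "c \<odot> w = 0"
    "u \<odot> u = (l * (1 - l)) *\<^sub>R c + l *\<^sub>R w" "2 *\<^sub>R (u \<odot> w) = (1 - l) *\<^sub>R u" "w \<odot> w = (1 - l) *\<^sub>R w"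
    "l = 0 \<Longrightarrow> u = 0" "l \<noteq> 0 \<Longrightarrow> B c c = B d d" "B c d = l * B c c"
proof -
  have cc: "c \<odot> c = c" and dd: "d \<odot> d = d" using assms by (auto simp: prim_idem)
  obtain x1 u w where dec: "d = x1 + u + w" "c \<odot> x1 = x1" "c \<odot> u = (1/2) *\<^sub>R u" "c \<odot> w = 0"
    using peirce_decomp[OF cc] .
  obtain l where x1: "x1 = l *\<^sub>R c" using prim_peirce_1[OF c dec(2)] .
  obtain s1 sh s0 where s: "u \<odot> u = s1 + sh + s0" "c \<odot> s1 = s1" "c \<odot> sh = (1/2) *\<^sub>R sh" "c \<odot> s0 = 0"
    using peirce_decomp[OF cc] .
  have "sh = 0"
  proof -
    have "c \<odot> (c \<odot> (u \<odot> u)) = c \<odot> (u \<odot> u)" by (rule peirce_hh[OF cc dec(3) dec(3)])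
    then have "(1/4) *\<^sub>R sh = (1/2) *\<^sub>R sh" using s by (simp add: jp_simps)
    then show ?thesis by simp
  qed
  obtain t where s1: "s1 = t *\<^sub>R c" using prim_peirce_1[OF c s(2)] .
  have uu: "u \<odot> u = t *\<^sub>R c + s0" using s s1 \<open>sh = 0\<close> by simp
  have uc: "u \<odot> c = (1/2) *\<^sub>R u" "w \<odot> c = 0" "w \<odot> u = u \<odot> w"
    using dec by (simp_all add: commute)
  have "d \<odot> d = (l * l + t) *\<^sub>R c + (l *\<^sub>R u + 2 *\<^sub>R (u \<odot> w)) + (s0 + w \<odot> w)"
    unfolding dec(1) x1 by (simp add: jp_simps cc dec(3,4) uc uu algebra_simps scaleR_2)
      (simp flip: scaleR_2)
  then have eq: "(l * l + t) *\<^sub>R c + (l *\<^sub>R u + 2 *\<^sub>R (u \<odot> w)) + (s0 + w \<odot> w) = l *\<^sub>R c + u + w"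
    using dd dec(1) x1 by simp
  have uw: "c \<odot> (u \<odot> w) = (1/2) *\<^sub>R (u \<odot> w)"
    using peirce_0h[OF cc dec(4,3)] by (simp add: uc)
  have ww: "c \<odot> (w \<odot> w) = 0" by (rule peirce_00[OF cc dec(4) dec(4)])
  have comp: "(l * l + t) *\<^sub>R c = l *\<^sub>R c" "l *\<^sub>R u + 2 *\<^sub>R (u \<odot> w) = u" "s0 + w \<odot> w = w"
    by (rule peirce_unique[OF cc eq]; simp add: jp_simps cc dec(3,4) uw ww s scaleR_right_distrib)+
  have t: "t = l * (1 - l)"
  proof -
    have "l * l + t = l" using comp(1) prim_nonzero[OF c] by (simp only: scaleR_cancel_right) simp
    then show ?thesis by (simp add: algebra_simps)
  qed
  \<comment> \<open>\<open>P\<close> is the 1-component of \<open>c\<close> for the idempotent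
    \<open>d\<close>, thus \<open>m d\<close>. Its components for \<open>c\<close> give
    \<open>m = l\<close> if \<open>l\<close> is not 0, and pairing it with \<open>d\<close> gives
    \<open>l B d d = B c d = l B c c\<close>.\<close>
  define P where "P = 2 *\<^sub>R (d \<odot> (d \<odot> c)) - d \<odot> c"
  obtain m where m: "P = m *\<^sub>R d"
    using prim_peirce_1[OF d peirce_one_part[OF dd, of c]] unfolding P_def by metis
  have dc: "d \<odot> c = l *\<^sub>R c + (1/2) *\<^sub>R u"
    unfolding dec(1) x1 by (simp add: jp_simps cc uc)
  have "d \<odot> u = (l/2) *\<^sub>R u + u \<odot> u + u \<odot> w"
    unfolding dec(1) x1 by (simp add: jp_simps dec(3) uc)
  then have "P = 2 *\<^sub>R (l *\<^sub>R (l *\<^sub>R c + (1/2) *\<^sub>R u)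
      + (1/2) *\<^sub>R ((l/2) *\<^sub>R u + u \<odot> u + u \<odot> w)) - (l *\<^sub>R c + (1/2) *\<^sub>R u)"
    unfolding P_def by (simp only: dc jp_simps)
  also have "\<dots> = (2 * l * l - l) *\<^sub>R c + (3/2 * l - 1/2) *\<^sub>R u + u \<odot> u + (1/2) *\<^sub>R (2 *\<^sub>R (u \<odot> w))"
    by (rule euclidean_eqI) (simp add: algebra_simps)
  also have "2 *\<^sub>R (u \<odot> w) = u - l *\<^sub>R u" using comp(2) by (metis add_diff_cancel_left')
  also have "(2 * l * l - l) *\<^sub>R c + (3/2 * l - 1/2) *\<^sub>R u + u \<odot> u + (1/2) *\<^sub>R (u - l *\<^sub>R u)
      = (l * l) *\<^sub>R c + l *\<^sub>R u + s0"
    unfolding uu t by (rule euclidean_eqI) (simp add: algebra_simps)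
  finally have P: "(l * l) *\<^sub>R c + l *\<^sub>R u + s0 = (m * l) *\<^sub>R c + m *\<^sub>R u + m *\<^sub>R w"
    unfolding m dec(1) x1 by (simp add: algebra_simps)
  have Pc: "(l * l) *\<^sub>R c = (m * l) *\<^sub>R c" "s0 = m *\<^sub>R w"
    by (rule peirce_unique[OF cc P]; simp add: jp_simps cc dec(3,4) s)+
  then have lm: "l = m" if "l \<noteq> 0" using that prim_nonzero[OF c] by simp
  have u0: "u = 0" if "l = 0"
  proof -
    have "B (u \<odot> u) c = 0"
      using that t B_eigen_orthogonal[of c s0 0 c 1] s(4) cc by (simp add: uu B_simps)
    moreover have "B (u \<odot> u) c = B u u / 2" by (simp add: B_assoc uc B_simps)
    ultimately show ?thesis by (simp add: B_eq_0)
  qed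
  have s0: "s0 = l *\<^sub>R w"
  proof (cases "l = 0")
    case True
    then show ?thesis using u0 uu t by (simp add: jp_simps)
  next
    case False
    then show ?thesis using Pc lm by simp
  qed
  have Bcd: "B c d = l * B c c"
    using B_eigen_orthogonal[of c c 1 u "1/2"] B_eigen_orthogonal[of c c 1 w 0] dec(3,4) cc
    unfolding dec(1) x1 by (simp add: B_simps)
  have "B P d = B c d"
  proof -
    have "B (d \<odot> (d \<odot> c)) d = B (d \<odot> c) d" by (simp add: B_assoc_left dd)
    moreover have "B (d \<odot> c) d = B c d" by (simp add: B_assoc_left dd)
    ultimately show ?thesis by (simp add: P_def B_simps)
  qed
  then have Bdd: "B c c = B d d" if "l \<noteq> 0"
    using that lm[OF that] m Bcd by (simp add: B_simps)
  show ?thesis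
  proof (rule that)
    show "d = l *\<^sub>R c + u + w" using dec x1 by simp
    show "2 *\<^sub>R (u \<odot> w) = (1 - l) *\<^sub>R u" using comp(2) by (simp add: algebra_simps)
    show "w \<odot> w = (1 - l) *\<^sub>R w" using comp(3) s0 by (simp add: algebra_simps)
  qed (use dec uu t s0 u0 Bdd Bcd in auto)
qed

end

section \<open>Normalization of the associative form\<close>

locale jordan_trace_form = jordan_form +
  assumes B_prim: "primitive_idempotent jp c \<Longrightarrow> B c c = 1"

context jordan_form
begin

lemma prim_mult_zero:
  assumes "prim c" "prim d" "B c d = 0"
  shows "c \<odot> d = 0"
proof -
  obtain l u w where d: "d = l *\<^sub>R c + u + w" "c \<odot> w = 0" "l = 0 \<Longrightarrow> u = 0" "B c d = l * B c c"
    using prim_pair[OF assms(1,2)] by metis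
  have "l = 0" using d assms(3) B_pos[OF prim_nonzero[OF assms(1)]] by simp
  then show ?thesis using d by (simp add: jp_simps)
qed

lemma prim_mult_zero_of_unequal:
  assumes "prim c" "prim d" "B c c \<noteq> B d d"
  shows "c \<odot> d = 0"
proof -
  obtain l where "l \<noteq> 0 \<Longrightarrow> B c c = B d d" "B c d = l * B c c"
    using prim_pair[OF assms(1,2)] by metis
  then have "B c d = 0" using assms(3) by (cases "l = 0") auto
  then show ?thesis using prim_mult_zero assms by blast
qed

text \<open>Primitive idempotents that are not orthogonal have the same length for \<open>B\<close>, so dividing by
  that length gives a central element, and multiplying by it turns \<open>B\<close> into the trace form.\<close>

lemma normalized_form: "\<exists>T. jordan_trace_form jp e T"
proof -
  obtain F where F: "ortho_system F e" using spectral[of e] by metis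
  define w where "w = (\<Sum>c\<in>F. (1 / B c c) *\<^sub>R c)"
  have prF: "prim c" if "c \<in> F" for c using F that by (simp add: ortho_system_def)
  have wy: "w \<odot> y = (1/t) *\<^sub>R y" if y: "\<And>c. c \<in> F \<Longrightarrow> B c c \<noteq> t \<Longrightarrow> c \<odot> y = 0" for y t
  proof -
    have "w \<odot> y = (\<Sum>c\<in>F. (1/t) *\<^sub>R (c \<odot> y))"
      unfolding w_def jp_sum_left using y by (intro sum.cong refl) (force simp: jp_simps)
    also have "\<dots> = (1/t) *\<^sub>R ((\<Sum>F) \<odot> y)" by (simp add: scaleR_sum_right jp_sum_left)
    finally show ?thesis using F by (simp add: ortho_system_def unit_left)
  qed
  have wd: "w \<odot> d = (1 / B d d) *\<^sub>R d" if "prim d" for d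
    using prim_mult_zero_of_unequal prF that by (intro wy) blast
  have wcd: "w \<odot> (c \<odot> d) = (w \<odot> c) \<odot> d" if c: "prim c" and d: "prim d" for c d
  proof (cases "B c c = B d d")
    case False
    then have "c \<odot> d = 0" using prim_mult_zero_of_unequal c d by blast
    then show ?thesis by (simp add: wd c jp_simps)
  next
    case True
    \<comment> \<open>\<open>g\<close> sums the frame members as long as \<open>c\<close>. It fixes
      every primitive idempotent of that length, so \<open>c \<odot> d\<close> lies in its 1-space
      and is annihilated by the other frame members; there \<open>w\<close> acts as the scalar
      \<open>1 / B c c\<close>.\<close>
    define G where "G = {f\<in>F. B f f = B c c}"
    define g where "g = \<Sum>G"
    have G: "ortho_system G g" using F by (auto simp: ortho_system_def G_def g_def)
    have gg: "g \<odot> g = g"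
      using ortho_system_unit[OF G] by (subst (2) g_def) (simp add: jp_sum_right g_def)
    have g1: "g \<odot> h = h" if h: "prim h" "B h h = B c c" for h
    proof -
      have "g \<odot> h = (\<Sum>f\<in>F. f \<odot> h)"
        unfolding g_def jp_sum_left
        using F h prim_mult_zero_of_unequal[OF prF h(1)]
        by (intro sum.mono_neutral_left) (auto simp: G_def ortho_system_def)
      also have "\<dots> = h" using F by (simp add: jp_sum_left[symmetric] ortho_system_def unit_left)
      finally show ?thesis .
    qed
    have g0: "g \<odot> f = 0" if "f \<in> F" "B f f \<noteq> B c c" for f
      unfolding g_def jp_sum_left using F that by (intro sum.neutral) (auto simp: ortho_system_def G_def)
    have gcd: "g \<odot> (c \<odot> d) = c \<odot> d" using peirce_11[OF gg g1 g1] c d True by simp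
    have "w \<odot> (c \<odot> d) = (1 / B c c) *\<^sub>R (c \<odot> d)"
      using peirce_10[OF gg gcd g0] by (intro wy) (simp add: commute)
    then show ?thesis by (simp add: wd c jp_simps)
  qed
  have central: "w \<odot> (x \<odot> y) = (w \<odot> x) \<odot> y" for x y
  proof -
    obtain X l where X: "ortho_system X e" "x = (\<Sum>c\<in>X. l c *\<^sub>R c)" using spectral .
    obtain Y k where Y: "ortho_system Y e" "y = (\<Sum>c\<in>Y. k c *\<^sub>R c)" using spectral .
    have "w \<odot> (c \<odot> d) = (w \<odot> c) \<odot> d" if "c \<in> X" "d \<in> Y" for c d
      using wcd X Y that by (simp add: ortho_system_def)
    then show ?thesis unfolding X(2) Y(2)
      by (simp add: jp_sum_left jp_sum_right jp_simps)
  qed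
  \<comment> \<open>Centrality of \<open>w\<close> keeps the form associative, and \<open>w\<close>
    scales each primitive idempotent by the reciprocal of its length under \<open>B\<close>.\<close>
  let ?T = "\<lambda>x y. B (w \<odot> x) y"
  have "jordan_trace_form jp e ?T"
  proof unfold_locales
    show "bilinear ?T"
      unfolding bilinear_def by (auto intro!: linearI simp: jp_simps B_simps)
    show "?T (x \<odot> y) z = ?T x (y \<odot> z)" for x y z by (simp add: central B_assoc)
    show "?T c c = 1" if "primitive_idempotent jp c" for c
      using that B_pos[OF prim_nonzero[OF that]] by (simp add: wd B_simps)
    show "?T x x > 0" if x0: "x \<noteq> 0" for x
    proof -
      obtain X l where X: "ortho_system X e" "x = (\<Sum>c\<in>X. l c *\<^sub>R c)" using spectral .
      have fin: "finite X" using X by (simp add: ortho_system_def)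
      have Tc: "?T x c = l c" if c: "c \<in> X" for c
      proof -
        have pc: "prim c" using X c by (simp add: ortho_system_def)
        have "?T x c = B w (x \<odot> c)" by (simp add: B_assoc)
        also have "\<dots> = l c * B w c"
          using ortho_system_mult[OF X(1) c, of l] X(2) by (simp add: B_simps)
        also have "B w c = 1"
          using pc B_unit[of w c] wd[OF pc] B_unit[of c c] B_pos[OF prim_nonzero[OF pc]]
          by (simp add: B_simps prim_idem)
        finally show ?thesis by simp
      qed
      have "?T x x = (\<Sum>c\<in>X. l c * ?T x c)"
        by (subst (2) X(2)) (simp add: B_sum_right B_simps)
      also have "\<dots> = (\<Sum>c\<in>X. (l c)\<^sup>2)"
        using Tc by (intro sum.cong) (auto simp: power2_eq_square)
      finally have eq: "?T x x = (\<Sum>c\<in>X. (l c)\<^sup>2)" .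
      obtain c where "c \<in> X" "l c \<noteq> 0"
      proof -
        have "\<exists>c\<in>X. l c \<noteq> 0"
        proof (rule ccontr)
          assume "\<not> (\<exists>c\<in>X. l c \<noteq> 0)"
          then have "x = 0" using X(2) by simp
          with x0 show False by simp
        qed
        then show thesis using that by blast
      qed
      then have "(\<Sum>c\<in>X. (l c)\<^sup>2) > 0" using fin by (intro sum_pos2[of X c]) auto
      with eq show ?thesis by simp
    qed
  qed
  then show ?thesis by blast
qed

end

section \<open>Rank, Jordan frames and the trace\<close>

context jordan_trace_form
begin

lemma B_e_prim: "prim c \<Longrightarrow> B e c = 1"
  using B_unit[of c c] by (simp add: prim_idem B_prim)

lemma card_ortho_system:
  assumes "ortho_system F e"
  shows "real (card F) = B e e"
proof -
  have "B e e = (\<Sum>c\<in>F. B e c)" using assms B_sum_right[of e "\<lambda>c. c" F] by (simp add: ortho_system_def)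
  also have "\<dots> = real (card F)" using assms B_e_prim by (simp add: ortho_system_def)
  finally show ?thesis by simp
qed

lemma jpower_spectral:
  assumes "ortho_system F e" "x = (\<Sum>c\<in>F. l c *\<^sub>R c)"
  shows "jpower jp e x n = (\<Sum>c\<in>F. l c ^ n *\<^sub>R c)"
proof (induction n)
  case 0
  then show ?case using assms by (simp add: ortho_system_def)
next
  case (Suc n)
  have "x \<odot> c = l c *\<^sub>R c" if "c \<in> F" for c
    using ortho_system_mult[OF assms(1) that] assms(2) by simp
  then show ?case by (simp add: Suc jp_sum_right jp_simps mult.commute)
qed

text \<open>The polynomial whose roots are the eigenvalues of \<open>x\<close> annihilates
  \<open>x\<close>, which bounds the rank from above. Conversely, a relation between the powers of
  an element with distinct eigenvalues is a nonzero polynomial with \<open>card F\<close>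
  roots.\<close>

lemma jrank_eq_card:
  assumes F: "ortho_system F e"
  shows "jrank jp e = card F"
  unfolding jrank_def
proof (rule Least_equality)
  show "\<forall>x. \<exists>u. (\<exists>i\<le>card F. u i \<noteq> 0) \<and> (\<Sum>i\<le>card F. u i *\<^sub>R jpower jp e x i) = 0"
  proof
    fix x
    obtain G l where G: "ortho_system G e" "x = (\<Sum>c\<in>G. l c *\<^sub>R c)" using spectral .
    have fin: "finite G" using G by (simp add: ortho_system_def)
    have card: "card F = card G" using card_ortho_system F G by (metis of_nat_eq_iff)
    define p where "p = (\<Prod>c\<in>G. [:- l c, 1:])"
    have deg: "degree p = card F"
      unfolding p_def card by (subst degree_prod_eq_sum_degree) auto
    have root: "poly p (l c) = 0" if "c \<in> G" for c
      using fin that by (auto simp: p_def poly_prod)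
    have "p \<noteq> 0" using fin by (simp add: p_def)
    then have "coeff p (card F) \<noteq> 0" using deg by (metis leading_coeff_0_iff)
    moreover have "(\<Sum>i\<le>card F. coeff p i *\<^sub>R jpower jp e x i)
        = (\<Sum>i\<le>card F. \<Sum>c\<in>G. (coeff p i * l c ^ i) *\<^sub>R c)"
      unfolding jpower_spectral[OF G] by (simp add: scaleR_sum_right)
    moreover have "\<dots> = (\<Sum>c\<in>G. poly p (l c) *\<^sub>R c)"
      by (subst sum.swap) (simp add: poly_altdef deg scaleR_sum_left)
    ultimately show "\<exists>u. (\<exists>i\<le>card F. u i \<noteq> 0) \<and> (\<Sum>i\<le>card F. u i *\<^sub>R jpower jp e x i) = 0"
      using root by (intro exI[of _ "coeff p"]) auto
  qed
next
  fix y
  assume y: "\<forall>x. \<exists>u. (\<exists>i\<le>y. u i \<noteq> 0) \<and> (\<Sum>i\<le>y. u i *\<^sub>R jpower jp e x i) = 0"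
  have fin: "finite F" using F by (simp add: ortho_system_def)
  \<comment> \<open>Any injective labelling of the frame will do; it only serves to make the
    eigenvalues of \<open>x\<close> distinct.\<close>
  obtain f :: "'a \<Rightarrow> nat" where f: "inj_on f F"
    using fin finite_imp_inj_to_nat_seg by metis
  define x where "x = (\<Sum>c\<in>F. real (f c) *\<^sub>R c)"
  obtain u where u: "\<exists>i\<le>y. u i \<noteq> 0" "(\<Sum>i\<le>y. u i *\<^sub>R jpower jp e x i) = 0" using y by blast
  define p where "p = (\<Sum>i\<le>y. monom (u i) i)"
  have coeff: "coeff p i = (if i \<le> y then u i else 0)" for i
    by (simp add: p_def coeff_sum if_distrib cong: if_cong)
  then have p0: "p \<noteq> 0" using u(1) by (metis coeff_0)
  have deg: "degree p \<le> y" by (rule degree_le) (simp add: coeff)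
  have "poly p (real (f c)) = 0" if c: "c \<in> F" for c
  proof -
    have "(\<Sum>i\<le>y. u i *\<^sub>R jpower jp e x i) = (\<Sum>i\<le>y. \<Sum>c\<in>F. (u i * real (f c) ^ i) *\<^sub>R c)"
      unfolding jpower_spectral[OF F x_def] by (simp add: scaleR_sum_right)
    also have "\<dots> = (\<Sum>c\<in>F. poly p (real (f c)) *\<^sub>R c)"
      by (subst sum.swap) (simp add: p_def poly_sum poly_monom scaleR_sum_left)
    finally have "(\<Sum>c\<in>F. poly p (real (f c)) *\<^sub>R c) = 0" using u(2) by simp
    then have "poly p (real (f c)) *\<^sub>R c = 0"
      using ortho_system_mult[OF F c, of "\<lambda>c. poly p (real (f c))"] by (simp add: jp_simps)
    then show ?thesis using prim_nonzero F c by (auto simp: ortho_system_def)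
  qed
  then have "(\<lambda>c. real (f c)) ` F \<subseteq> {z. poly p z = 0}" by auto
  then have "card ((\<lambda>c. real (f c)) ` F) \<le> card {z. poly p z = 0}"
    by (intro card_mono poly_roots_finite p0)
  also have "\<dots> \<le> degree p" by (rule card_poly_roots_bound[OF p0])
  also have "card ((\<lambda>c. real (f c)) ` F) = card F"
    using f by (intro card_image) (auto simp: inj_on_def)
  finally show "card F \<le> y" using deg by simp
qed

abbreviation r :: nat where "r \<equiv> jrank jp e"
abbreviation frame :: "(nat \<Rightarrow> 'a) \<Rightarrow> bool" where "frame \<equiv> jordan_frame jp e"

lemma frame_prim: "frame c \<Longrightarrow> i < r \<Longrightarrow> prim (c i)"
  by (simp add: jordan_frame_def)

lemma spectral_frame:
  obtains l c where "frame c" "x = (\<Sum>i<r. l i *\<^sub>R c i)"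
proof -
  obtain F l where F: "ortho_system F e" "x = (\<Sum>c\<in>F. l c *\<^sub>R c)" using spectral .
  have fin: "finite F" using F by (simp add: ortho_system_def)
  obtain h where h: "bij_betw h {..<r} F"
    using ex_bij_betw_nat_finite[OF fin] by (auto simp: jrank_eq_card[OF F(1)] atLeast0LessThan)
  have "frame h"
    unfolding jordan_frame_def
  proof (intro conjI allI impI)
    show "prim (h i)" if "i < r" for i
      using F h that by (auto simp: ortho_system_def bij_betw_def)
    show "h i \<odot> h j = 0" if "i < r" "j < r" "i \<noteq> j" for i j
    proof -
      have "h i \<in> F" "h j \<in> F" "h i \<noteq> h j" using h that by (auto simp: bij_betw_def inj_on_def)
      then show ?thesis using F by (simp add: ortho_system_def)
    qed
    show "(\<Sum>i<r. h i) = e"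
      using sum.reindex_bij_betw[OF h, of "\<lambda>c. c"] F by (simp add: ortho_system_def)
  qed
  moreover have "x = (\<Sum>i<r. l (h i) *\<^sub>R h i)"
    using sum.reindex_bij_betw[OF h, of "\<lambda>c. l c *\<^sub>R c"] F by simp
  ultimately show ?thesis by (rule that)
qed

lemma jeig_frame:
  obtains c where "frame c" "x = (\<Sum>i<r. jeig jp e x i *\<^sub>R c i)"
proof -
  obtain l c where "frame c" "x = (\<Sum>i<r. l i *\<^sub>R c i)" using spectral_frame .
  then have "\<exists>l. \<exists>c. frame c \<and> x = (\<Sum>i<r. l i *\<^sub>R c i)" by blast
  then have "\<exists>c. frame c \<and> x = (\<Sum>i<r. jeig jp e x i *\<^sub>R c i)"
    unfolding jeig_def by (rule someI_ex)
  then show ?thesis using that by blast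
qed

lemma frame_mult:
  assumes "frame c"
  shows "(\<Sum>i<r. a i *\<^sub>R c i) \<odot> (\<Sum>i<r. b i *\<^sub>R c i) = (\<Sum>i<r. (a i * b i) *\<^sub>R c i)"
proof -
  have "(\<Sum>j<r. (a i *\<^sub>R c i) \<odot> (b j *\<^sub>R c j)) = (a i * b i) *\<^sub>R c i" if i: "i < r" for i
  proof -
    have "(\<Sum>j<r. (a i *\<^sub>R c i) \<odot> (b j *\<^sub>R c j)) = (\<Sum>j<r. if j = i then (a i * b i) *\<^sub>R c i else 0)"
      using assms i prim_idem frame_prim[OF assms i]
      by (intro sum.cong) (auto simp: jp_simps jordan_frame_def)
    then show ?thesis using i by simp
  qed
  then show ?thesis by (subst jp_sum_left) (simp add: jp_sum_right)
qed

lemma frame_B_e: "frame c \<Longrightarrow> B e (\<Sum>i<r. a i *\<^sub>R c i) = (\<Sum>i<r. a i)"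
  by (simp add: B_sum_right B_simps frame_prim B_e_prim)

lemma frame_B:
  assumes "frame c"
  shows "B (\<Sum>i<r. a i *\<^sub>R c i) (\<Sum>i<r. b i *\<^sub>R c i) = (\<Sum>i<r. a i * b i)"
  by (subst B_unit[symmetric]) (simp only: frame_mult[OF assms] frame_B_e[OF assms])

lemma frame_single: "frame c \<Longrightarrow> i < r \<Longrightarrow> c i = (\<Sum>j<r. (if j = i then 1 else 0) *\<^sub>R c j)"
  by (simp add: if_distrib[of "\<lambda>a. a *\<^sub>R _"] cong: if_cong)

lemma frame_B_single:
  assumes "frame c" "i < r"
  shows "B (\<Sum>i<r. a i *\<^sub>R c i) (c i) = a i"
proof -
  have "B (\<Sum>i<r. a i *\<^sub>R c i) (c i) = (\<Sum>j<r. a j * (if j = i then 1 else 0))"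
    using frame_B[OF assms(1), of a "\<lambda>j. if j = i then 1 else 0"]
    by (simp only: frame_single[OF assms, symmetric])
  then show ?thesis using assms(2) by (simp add: if_distrib cong: if_cong)
qed

lemma frame_B_sum: "frame c \<Longrightarrow> (\<Sum>i<r. B x (c i)) = B e x"
  by (simp add: B_sum_right[symmetric] jordan_frame_def B_sym[of e])

text \<open>Every decomposition along a frame has eigenvalue sum \<open>B e x\<close>, so the choice
  made in \<open>jeig\<close> does not matter and the trace is linear.\<close>

lemma jtrace_eq: "jtrace jp e x = B e x"
  using jeig_frame[of x] frame_B_e unfolding jtrace_def by metis

lemma jinner_eq: "jinner jp e x y = B x y"
  by (simp add: jinner_def jtrace_eq B_unit)

lemma jnorm_F_eq: "jnorm_F jp e x = sqrt (B x x)"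
  by (simp add: jnorm_F_def jinner_eq)

lemma B_e_e: "B e e = real r"
  using spectral[of e] card_ortho_system jrank_eq_card by metis

lemma e_nonzero: "e \<noteq> 0"
proof
  assume "e = 0"
  then have "x = 0" for x :: 'a using unit[of x] by (simp add: jp_simps)
  moreover obtain b :: 'a where "b \<in> Basis" using nonempty_Basis by blast
  ultimately show False using nonzero_Basis by blast
qed

lemma r_pos: "0 < r"
  using B_e_e B_pos[OF e_nonzero] by simp

subsection \<open>The cone of squares\<close>

text \<open>The closed cone of squares in dual form, identified in \<open>squares_eq\<close>;
  closedness and convexity are immediate from this description.\<close>

definition K :: "'a set" where "K = {x. \<forall>d. prim d \<longrightarrow> 0 \<le> B x d}"

lemma frame_K:
  assumes "frame c"
  shows "(\<Sum>i<r. a i *\<^sub>R c i) \<in> K \<longleftrightarrow> (\<forall>i<r. 0 \<le> a i)"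
proof
  assume "(\<Sum>i<r. a i *\<^sub>R c i) \<in> K"
  then show "\<forall>i<r. 0 \<le> a i"
    using frame_B_single[OF assms, of _ a] frame_prim[OF assms] by (force simp: K_def)
next
  assume a: "\<forall>i<r. 0 \<le> a i"
  have "B (c i) d \<ge> 0" if "i < r" "prim d" for i d
    using B_idempotent_square[OF prim_idem[OF that(2)], of "c i"] prim_idem frame_prim assms that by simp
  with a show "(\<Sum>i<r. a i *\<^sub>R c i) \<in> K"
    by (auto simp: K_def B_sum_left B_simps intro!: sum_nonneg)
qed

lemma squares_eq: "range (\<lambda>x. x \<odot> x) = K"
proof
  show "range (\<lambda>x. x \<odot> x) \<subseteq> K"
    using B_idempotent_square prim_idem by (auto simp: K_def)
  show "K \<subseteq> range (\<lambda>x. x \<odot> x)"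
  proof
    fix x assume x: "x \<in> K"
    obtain l c where c: "frame c" "x = (\<Sum>i<r. l i *\<^sub>R c i)" using spectral_frame .
    then have "\<forall>i<r. 0 \<le> l i" using x frame_K by blast
    then have "x = (\<Sum>i<r. sqrt (l i) *\<^sub>R c i) \<odot> (\<Sum>i<r. sqrt (l i) *\<^sub>R c i)"
      using c by (simp add: frame_mult)
    then show "x \<in> range (\<lambda>x. x \<odot> x)" by blast
  qed
qed

lemma prim_in_K: "prim c \<Longrightarrow> c \<in> K"
  using squares_eq prim_idem by (metis rangeI)

lemma K_B_nonneg:
  assumes "x \<in> K" "y \<in> K"
  shows "0 \<le> B x y"
proof -
  obtain l c where c: "frame c" "y = (\<Sum>i<r. l i *\<^sub>R c i)" using spectral_frame .
  then have "\<forall>i<r. 0 \<le> l i" using assms frame_K by blast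
  then show ?thesis
    using assms frame_prim[OF c(1)] by (auto simp: c(2) B_sum_right B_simps K_def intro!: sum_nonneg)
qed

lemma closed_K: "closed K"
proof -
  have "K = (\<Inter>d\<in>Collect prim. {x. 0 \<le> B x d})" by (auto simp: K_def)
  moreover have "closed {x. 0 \<le> B x d}" for d
    by (intro closed_Collect_le continuous_on_const continuous_on_B continuous_on_id)
  ultimately show ?thesis by (simp add: closed_INT)
qed

lemma convex_K: "convex K"
  by (auto simp: convex_def K_def B_simps)

text \<open>An interior point stays in \<open>K\<close> after subtracting a small multiple
  \<open>m e\<close>, which gives the uniform margin \<open>m\<close>. Conversely, primitive
  idempotents have length 1, so by Cauchy-Schwarz a margin \<open>m\<close> leaves room for a ball
  of radius \<open>m\<close> in the form \<open>B\<close>.\<close>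

lemma jcone_eq: "jcone jp = {x. \<exists>m>0. \<forall>d. prim d \<longrightarrow> m \<le> B x d}"
proof
  show "jcone jp \<subseteq> {x. \<exists>m>0. \<forall>d. prim d \<longrightarrow> m \<le> B x d}"
  proof
    fix x assume "x \<in> jcone jp"
    then obtain t where t: "t > 0" "ball x t \<subseteq> K"
      unfolding jcone_def squares_eq mem_interior by blast
    define m where "m = t / (2 * norm e)"
    have m: "m > 0" using t e_nonzero by (simp add: m_def)
    have "x - m *\<^sub>R e \<in> ball x t" using t e_nonzero by (simp add: m_def dist_norm)
    then have "x - m *\<^sub>R e \<in> K" using t by blast
    then have "m \<le> B x d" if "prim d" for d
      using that by (auto simp: K_def B_simps B_e_prim)
    with m show "x \<in> {x. \<exists>m>0. \<forall>d. prim d \<longrightarrow> m \<le> B x d}" by blast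
  qed
  show "{x. \<exists>m>0. \<forall>d. prim d \<longrightarrow> m \<le> B x d} \<subseteq> jcone jp"
  proof
    fix x assume "x \<in> {x. \<exists>m>0. \<forall>d. prim d \<longrightarrow> m \<le> B x d}"
    then obtain m where m: "m > 0" "\<And>d. prim d \<Longrightarrow> m \<le> B x d" by blast
    let ?U = "{y. B (y - x) (y - x) < m\<^sup>2}"
    have "open ?U"
      by (intro open_Collect_less continuous_on_B continuous_intros)
    moreover have "x \<in> ?U" using m by (simp add: B_simps)
    moreover have "?U \<subseteq> K"
    proof
      fix y assume "y \<in> ?U"
      then have "sqrt (B (y - x) (y - x)) \<le> m"
        using m by (metis mem_Collect_eq less_imp_le real_le_lsqrt)
      moreover have "\<bar>B (y - x) d\<bar> \<le> sqrt (B (y - x) (y - x))" if "prim d" for d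
        using B_Cauchy_Schwarz[of "y - x" d] B_prim[OF that] by simp
      moreover have "B y d = B x d + B (y - x) d" for d by (simp add: B_simps)
      ultimately show "y \<in> K" unfolding K_def using m(2) by fastforce
    qed
    ultimately show "x \<in> jcone jp" unfolding jcone_def squares_eq by (rule interiorI)
  qed
qed

lemma frame_jcone:
  assumes "frame c"
  shows "(\<Sum>i<r. a i *\<^sub>R c i) \<in> jcone jp \<longleftrightarrow> (\<forall>i<r. 0 < a i)"
proof
  assume "(\<Sum>i<r. a i *\<^sub>R c i) \<in> jcone jp"
  then show "\<forall>i<r. 0 < a i"
    using frame_B_single[OF assms, of _ a] frame_prim[OF assms] by (force simp: jcone_eq)
next
  assume a: "\<forall>i<r. 0 < a i"
  define m where "m = Min (a ` {..<r})"
  have "{..<r} \<noteq> {}" using r_pos by auto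
  then have m: "m > 0" "\<And>i. i < r \<Longrightarrow> m \<le> a i" using a by (auto simp: m_def)
  have "m \<le> B (\<Sum>i<r. a i *\<^sub>R c i) d" if d: "prim d" for d
  proof -
    have "(\<Sum>i<r. (a i - m) *\<^sub>R c i) \<in> K" using frame_K[OF assms] m by simp
    moreover have "(\<Sum>i<r. (a i - m) *\<^sub>R c i) = (\<Sum>i<r. a i *\<^sub>R c i) - m *\<^sub>R e"
      using assms by (simp add: scaleR_left_diff_distrib sum_subtractf scaleR_sum_right[symmetric] jordan_frame_def)
    ultimately show ?thesis using d by (auto simp: K_def B_simps B_e_prim)
  qed
  with m show "(\<Sum>i<r. a i *\<^sub>R c i) \<in> jcone jp" by (auto simp: jcone_eq)
qed

lemma e_in_jcone: "e \<in> jcone jp"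
  by (auto simp: jcone_eq B_e_prim intro!: exI[of _ 1])

lemma jcone_K: "x \<in> jcone jp \<Longrightarrow> x \<in> K"
  using interior_subset unfolding jcone_def squares_eq by blast

lemma closure_jcone: "closure (jcone jp) = K"
  using convex_closure_interior[OF convex_K] closed_K e_in_jcone
  unfolding jcone_def squares_eq by (auto simp: closure_closed)

text \<open>Moreau decomposition: cutting the eigenvalues off at 0 gives \<open>p\<close> in
  \<open>K\<close> with \<open>v - p\<close> orthogonal to \<open>p\<close> and nonpositive against
  \<open>K\<close>. This makes \<open>p\<close> the unique nearest point and gives the second
  claim.\<close>

lemma jpos_part:
  shows "jpos_part jp e v \<in> K" "\<And>q. q \<in> K \<Longrightarrow> B v q \<le> B (jpos_part jp e v) q"
proof -
  obtain l c where c: "frame c" "v = (\<Sum>i<r. l i *\<^sub>R c i)" using spectral_frame .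
  define p where "p = (\<Sum>i<r. max (l i) 0 *\<^sub>R c i)"
  have pK: "p \<in> K" using frame_K[OF c(1)] by (simp add: p_def)
  have vp: "v - p = (\<Sum>i<r. min (l i) 0 *\<^sub>R c i)"
    unfolding c(2) p_def sum_subtractf[symmetric] scaleR_left_diff_distrib[symmetric]
    by (intro sum.cong) auto
  have z: "B (v - p) p = 0"
    unfolding vp unfolding p_def frame_B[OF c(1)] by (intro sum.neutral) (auto simp: min_def max_def)
  have neg: "B (v - p) q \<le> 0" if "q \<in> K" for q
    unfolding vp B_sum_left B_simps real_scaleR_def
    using that frame_prim[OF c(1)]
    by (intro sum_nonpos mult_nonpos_nonneg) (auto simp: K_def B_sym[of _ q])
  have near: "B (v - q) (v - q) \<ge> B (v - p) (v - p) + B (p - q) (p - q)" if "q \<in> K" for q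
  proof -
    have "B (v - q) (v - q) = B (v - p) (v - p) + B (p - q) (p - q) + 2 * (B (v - p) p - B (v - p) q)"
      by (simp add: B_simps B_sym[of p v] B_sym[of q v] B_sym[of q p])
    then show ?thesis using z neg[OF that] by simp
  qed
  have "jpos_part jp e v = p"
    unfolding jpos_part_def jnorm_F_eq closure_jcone
  proof (rule the_equality)
    have "sqrt (B (v - p) (v - p)) \<le> sqrt (B (v - q) (v - q))" if "q \<in> K" for q
      using near[OF that] B_nonneg[of "p - q"] by simp
    then show "p \<in> K \<and> (\<forall>q\<in>K. sqrt (B (v - p) (v - p)) \<le> sqrt (B (v - q) (v - q)))" using pK by blast
  next
    fix q assume q: "q \<in> K \<and> (\<forall>x\<in>K. sqrt (B (v - q) (v - q)) \<le> sqrt (B (v - x) (v - x)))"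
    then have "B (v - q) (v - q) \<le> B (v - p) (v - p)" using pK by auto
    then have "B (p - q) (p - q) = 0" using near[of q] q B_nonneg[of "p - q"] by linarith
    then show "q = p" by (simp add: B_eq_0)
  qed
  then show "jpos_part jp e v \<in> K" "\<And>q. q \<in> K \<Longrightarrow> B v q \<le> B (jpos_part jp e v) q"
    using pK neg by (auto simp: B_simps)
qed

lemma orthogonal_projection_exists:
  assumes "finite S"
  shows "\<exists>p\<in>span S. \<forall>y\<in>span S. B (x - p) y = 0"
  using assms
proof (induction S arbitrary: x)
  case empty
  then show ?case by (simp add: B_simps)
next
  case (insert b S)
  obtain p where p: "p \<in> span S" "\<And>y. y \<in> span S \<Longrightarrow> B (x - p) y = 0" using insert.IH[of x] by blast
  obtain q where q: "q \<in> span S" "\<And>y. y \<in> span S \<Longrightarrow> B (b - q) y = 0" using insert.IH[of b] by blast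
  let ?b = "b - q"
  \<comment> \<open>Gram-Schmidt with respect to \<open>B\<close>; if \<open>?b = 0\<close>,
    division by 0 gives \<open>t = 0\<close>, and the identity for \<open>t * B ?b ?b\<close> below
    still holds.\<close>
  define t where "t = B (x - p) ?b / B ?b ?b"
  have S: "span S \<subseteq> span (insert b S)" by (rule span_mono) auto
  have "?b \<in> span (insert b S)" using q S by (auto intro: span_diff span_base)
  then have "p + t *\<^sub>R ?b \<in> span (insert b S)" using p S by (auto intro: span_add span_scale)
  moreover have "B (x - (p + t *\<^sub>R ?b)) y = 0" if "y \<in> span (insert b S)" for y
  proof -
    obtain k where "y - k *\<^sub>R b \<in> span S" using \<open>y \<in> span (insert b S)\<close> span_breakdown_eq by blast
    then have s': "y - k *\<^sub>R b + k *\<^sub>R q \<in> span S" using q by (auto intro: span_add span_scale)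
    define s where "s = y - k *\<^sub>R b + k *\<^sub>R q"
    have s: "s \<in> span S" "y = k *\<^sub>R ?b + s" using s' by (simp_all only: s_def) (simp add: algebra_simps)
    have "B (x - p) ?b = t * B ?b ?b"
      by (cases "?b = 0") (auto simp: t_def B_simps B_eq_0 simp del: B_simps(9,10))
    moreover have "B (x - p) s = 0" "B ?b s = 0" using p q s by auto
    moreover have "B (x - (p + t *\<^sub>R ?b)) y = k * (B (x - p) ?b - t * B ?b ?b) + (B (x - p) s - t * B ?b s)"
      unfolding s(2) by (simp add: B_simps algebra_simps)
    ultimately show ?thesis by simp
  qed
  ultimately show ?case by blast
qed

lemma jproj:
  assumes "subspace L"
  shows "jproj jp e L x \<in> L" "\<And>y. y \<in> L \<Longrightarrow> B (x - jproj jp e L x) y = 0"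
proof -
  obtain S where S: "S \<subseteq> L" "independent S" "L = span S"
    using basis_exists[of L] assms by (metis span_minimal subset_antisym)
  have "finite S" using S(2) independent_imp_finite by blast
  then obtain p where p: "p \<in> L" "\<And>y. y \<in> L \<Longrightarrow> B (x - p) y = 0"
    using orthogonal_projection_exists[of S x] S by blast
  have "jproj jp e L x = p"
    unfolding jproj_def jinner_eq
  proof (rule the_equality)
    show "p \<in> L \<and> (\<forall>y\<in>L. B (x - p) y = 0)" using p by blast
    fix q assume q: "q \<in> L \<and> (\<forall>y\<in>L. B (x - q) y = 0)"
    then have "p - q \<in> L" using p assms by (simp add: subspace_diff)
    then have "B (x - q) (p - q) - B (x - p) (p - q) = 0" using p q by simp
    then have "B (p - q) (p - q) = 0" by (simp add: B_simps)
    then show "q = p" by (simp add: B_eq_0)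
  qed
  with p show "jproj jp e L x \<in> L" "\<And>y. y \<in> L \<Longrightarrow> B (x - jproj jp e L x) y = 0" by auto
qed

subsection \<open>The logarithm of the determinant\<close>

text \<open>The matrix of the \<open>B (c i) (d j)\<close> is doubly stochastic, so \<open>ln t \<le> t - 1\<close> applied to the
  ratios \<open>m j / l i\<close> gives the tangent inequality for the concave function \<open>ln det\<close>.\<close>

lemma log_det_frames:
  assumes c: "frame c" "\<forall>i<r. 0 < l i" and d: "frame d" "\<forall>i<r. 0 < m i"
  shows "(\<Sum>j<r. ln (m j)) \<le> (\<Sum>i<r. ln (l i))
    + B (\<Sum>i<r. (1 / l i) *\<^sub>R c i) (\<Sum>j<r. m j *\<^sub>R d j) - real r"
proof -
  let ?s = "\<lambda>i j. B (c i) (d j)"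
  have row: "(\<Sum>j<r. ?s i j) = 1" if "i < r" for i
    using frame_B_sum[OF d(1), of "c i"] B_e_prim[OF frame_prim[OF c(1) that]] by simp
  have col: "(\<Sum>i<r. ?s i j) = 1" if "j < r" for j
    using frame_B_sum[OF c(1), of "d j"] B_e_prim[OF frame_prim[OF d(1) that]] by (simp add: B_sym)
  have nonneg: "0 \<le> ?s i j * (m j / l i - 1 - (ln (m j) - ln (l i)))" if "i < r" "j < r" for i j
  proof (rule mult_nonneg_nonneg)
    show "0 \<le> ?s i j" using K_B_nonneg prim_in_K frame_prim c d that by blast
    have "0 < l i" "0 < m j" using c d that by auto
    moreover from this have "ln (m j / l i) \<le> m j / l i - 1" by (intro ln_le_minus_one) auto
    ultimately show "0 \<le> m j / l i - 1 - (ln (m j) - ln (l i))" by (simp add: ln_div)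
  qed
  have "0 \<le> (\<Sum>i<r. \<Sum>j<r. ?s i j * (m j / l i - 1 - (ln (m j) - ln (l i))))"
    using nonneg by (intro sum_nonneg) auto
  also have "\<dots> = (\<Sum>i<r. \<Sum>j<r. (1 / l i) * (m j * ?s i j)) - (\<Sum>i<r. \<Sum>j<r. ?s i j)
      - (\<Sum>i<r. \<Sum>j<r. ln (m j) * ?s i j) + (\<Sum>i<r. \<Sum>j<r. ln (l i) * ?s i j)"
    unfolding sum_subtractf[symmetric] sum.distrib[symmetric]
    by (intro sum.cong refl) (simp add: algebra_simps)
  also have "(\<Sum>i<r. \<Sum>j<r. (1 / l i) * (m j * ?s i j)) = B (\<Sum>i<r. (1 / l i) *\<^sub>R c i) (\<Sum>j<r. m j *\<^sub>R d j)"
    by (subst B_sum_left) (simp add: B_sum_right B_simps)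
  also have "(\<Sum>i<r. \<Sum>j<r. ?s i j) = real r" by (simp add: row)
  also have "(\<Sum>i<r. \<Sum>j<r. ln (m j) * ?s i j) = (\<Sum>j<r. ln (m j))"
    by (subst sum.swap) (simp add: sum_distrib_left[symmetric] col)
  also have "(\<Sum>i<r. \<Sum>j<r. ln (l i) * ?s i j) = (\<Sum>i<r. ln (l i))"
    by (simp add: sum_distrib_left[symmetric] row)
  finally show ?thesis by simp
qed

lemma frame_inverse:
  assumes "frame c" "\<And>i. i < r \<Longrightarrow> l i \<noteq> 0"
  shows "(\<Sum>i<r. l i *\<^sub>R c i) \<odot> (\<Sum>i<r. (1 / l i) *\<^sub>R c i) = e"
proof -
  have "(\<Sum>i<r. (l i * (1 / l i)) *\<^sub>R c i) = (\<Sum>i<r. c i)"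
    using assms(2) by (intro sum.cong) auto
  then show ?thesis using assms(1) by (simp add: frame_mult jordan_frame_def)
qed

text \<open>Two decompositions of the same element are compared by the tangent inequality in both
  directions; the linear term is the pairing of the element with its inverse, which equals
  \<open>r\<close> and cancels.\<close>

lemma jdet_frame:
  assumes c: "frame c" "\<forall>i<r. 0 < l i"
  shows "jdet jp e (\<Sum>i<r. l i *\<^sub>R c i) = (\<Prod>i<r. l i)"
proof -
  let ?x = "\<Sum>i<r. l i *\<^sub>R c i"
  obtain d where d: "frame d" "?x = (\<Sum>i<r. jeig jp e ?x i *\<^sub>R d i)" using jeig_frame .
  define m where "m = jeig jp e ?x"
  have x: "?x = (\<Sum>i<r. m i *\<^sub>R d i)" using d by (simp add: m_def)
  have "?x \<in> jcone jp" using frame_jcone c by blast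
  then have m: "\<forall>i<r. 0 < m i" unfolding x using frame_jcone d by blast
  have tr: "B (\<Sum>i<r. (1 / k i) *\<^sub>R b i) (\<Sum>i<r. k i *\<^sub>R b i) = real r"
    if "frame b" "\<forall>i<r. 0 < k i" for k b
  proof -
    have "\<And>i. i < r \<Longrightarrow> k i \<noteq> 0" using that(2) by force
    then show ?thesis
      using frame_inverse[OF that(1), of k] by (subst B_sym, subst B_unit[symmetric]) (simp add: B_e_e)
  qed
  have "(\<Sum>i<r. ln (m i)) \<le> (\<Sum>i<r. ln (l i))"
    using log_det_frames[OF c d(1) m] tr[OF c] x by simp
  moreover have "(\<Sum>i<r. ln (l i)) \<le> (\<Sum>i<r. ln (m i))"
    using log_det_frames[OF d(1) m c] tr[OF d(1) m] x by simp
  moreover have "ln (\<Prod>i<r. m i) = (\<Sum>i<r. ln (m i))" "ln (\<Prod>i<r. l i) = (\<Sum>i<r. ln (l i))"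
    using m c by (intro ln_prod; auto)+
  ultimately have "ln (\<Prod>i<r. m i) = ln (\<Prod>i<r. l i)" by simp
  then have "(\<Prod>i<r. m i) = (\<Prod>i<r. l i)"
    using m c by (subst (asm) ln_inj_iff) (auto intro!: prod_pos)
  then show ?thesis by (simp add: jdet_def m_def)
qed

lemma ln_jdet_frame:
  assumes "frame c" "\<forall>i<r. 0 < l i"
  shows "ln (jdet jp e (\<Sum>i<r. l i *\<^sub>R c i)) = (\<Sum>i<r. ln (l i))"
  unfolding jdet_frame[OF assms] using assms(2) by (intro ln_prod) auto

lemma jdet_pos:
  assumes "x \<in> jcone jp"
  shows "0 < jdet jp e x"
proof -
  obtain c where c: "frame c" "x = (\<Sum>i<r. jeig jp e x i *\<^sub>R c i)" using jeig_frame .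
  then have "\<forall>i<r. 0 < jeig jp e x i" using assms frame_jcone by metis
  then show ?thesis unfolding jdet_def by (intro prod_pos) auto
qed

lemma scale_jcone:
  assumes "x \<in> jcone jp" "t > 0"
  shows "t *\<^sub>R x \<in> jcone jp" "jdet jp e (t *\<^sub>R x) = t ^ r * jdet jp e x"
proof -
  obtain l c where c: "frame c" "x = (\<Sum>i<r. l i *\<^sub>R c i)" using spectral_frame .
  have l: "\<forall>i<r. 0 < l i" using assms c frame_jcone by blast
  have tx: "t *\<^sub>R x = (\<Sum>i<r. (t * l i) *\<^sub>R c i)" by (simp add: c scaleR_sum_right)
  show "t *\<^sub>R x \<in> jcone jp" unfolding tx frame_jcone[OF c(1)] using l assms by simp
  show "jdet jp e (t *\<^sub>R x) = t ^ r * jdet jp e x"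
    unfolding tx using jdet_frame[OF c(1), of "\<lambda>i. t * l i"] jdet_frame[OF c(1) l] l assms c(2)
    by (simp add: prod.distrib)
qed

text \<open>\<open>z\<close> is the inverse of \<open>x\<close>, the gradient of ln det there. The
  third clause turns a margin of \<open>x\<close> in the cone into a bound on \<open>z\<close>,
  needed to control second-order terms.\<close>

lemma log_det_tangent:
  assumes "x \<in> jcone jp"
  obtains z where "x \<odot> z = e" "z \<in> K"
    "\<And>m d. 0 < m \<Longrightarrow> (\<And>d. prim d \<Longrightarrow> m \<le> B x d) \<Longrightarrow> prim d \<Longrightarrow> B z d \<le> 1 / m"
    "\<And>y. y \<in> jcone jp \<Longrightarrow> ln (jdet jp e y) \<le> ln (jdet jp e x) + B z y - real r"
proof -
  obtain l c where c: "frame c" "x = (\<Sum>i<r. l i *\<^sub>R c i)" using spectral_frame .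
  have l: "\<forall>i<r. 0 < l i" using assms c frame_jcone by blast
  define z where "z = (\<Sum>i<r. (1 / l i) *\<^sub>R c i)"
  show ?thesis
  proof (rule that)
    show "x \<odot> z = e" unfolding c(2) z_def using l by (intro frame_inverse[OF c(1)]) force
    show "z \<in> K" unfolding z_def frame_K[OF c(1)] using l by (simp add: less_imp_le)
    show "B z d \<le> 1 / m" if m: "0 < m" "\<And>d. prim d \<Longrightarrow> m \<le> B x d" and d: "prim d" for m d
    proof -
      have "B z d = (\<Sum>i<r. 1 / l i * B (c i) d)" by (simp add: z_def B_sum_left B_simps)
      also have "\<dots> \<le> (\<Sum>i<r. 1 / m * B (c i) d)"
      proof (intro sum_mono mult_right_mono)
        fix i assume i: "i \<in> {..<r}"
        then have "m \<le> l i" using m(2)[of "c i"] frame_prim[OF c(1)] frame_B_single[OF c(1)] c(2) by simp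
        then show "1 / l i \<le> 1 / m" using m by (simp add: frac_le)
        show "0 \<le> B (c i) d" using K_B_nonneg prim_in_K frame_prim[OF c(1)] d i by blast
      qed
      also have "\<dots> = 1 / m * (\<Sum>i<r. B d (c i))" by (simp add: sum_distrib_left B_sym[of d])
      also have "\<dots> = 1 / m" using frame_B_sum[OF c(1), of d] B_e_prim[OF d] by simp
      finally show ?thesis .
    qed
    show "ln (jdet jp e y) \<le> ln (jdet jp e x) + B z y - real r" if y: "y \<in> jcone jp" for y
    proof -
      obtain m d where d: "frame d" "y = (\<Sum>i<r. m i *\<^sub>R d i)" using spectral_frame .
      have m: "\<forall>i<r. 0 < m i" using y d frame_jcone by blast
      show ?thesis
        unfolding z_def c(2) d(2) ln_jdet_frame[OF c(1) l] ln_jdet_frame[OF d(1) m]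
        by (rule log_det_frames[OF c(1) l d(1) m])
    qed
  qed
qed

subsection \<open>The quadratic mapping of a primitive idempotent\<close>

context
  fixes c
  assumes c: "prim c"
begin

lemmas c_idem = prim_idem[OF c]

text \<open>The parameter is \<open>s = 1 + a\<close>: the mapping acts on the Peirce spaces for 1,
  1/2, 0 as \<open>s^2\<close>, \<open>s\<close>, 1, so composition multiplies parameters.\<close>

definition D :: "real \<Rightarrow> 'a \<Rightarrow> 'a" where "D s = jquad jp (e + (s - 1) *\<^sub>R c)"

lemma D_eq: "D s x = x + (2 * (s - 1)) *\<^sub>R (c \<odot> x) + (s - 1)\<^sup>2 *\<^sub>R (2 *\<^sub>R (c \<odot> (c \<odot> x)) - c \<odot> x)"
  unfolding D_def jquad_def
  by (simp add: jp_simps c_idem unit unit_left, rule euclidean_eqI)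
    (simp add: algebra_simps power2_eq_square)

lemma D_peirce:
  assumes "c \<odot> x1 = x1" "c \<odot> xh = (1/2) *\<^sub>R xh" "c \<odot> x0 = 0"
  shows "D s (x1 + xh + x0) = s\<^sup>2 *\<^sub>R x1 + s *\<^sub>R xh + x0"
  unfolding D_eq
  by (simp add: jp_simps assms, rule euclidean_eqI) (simp add: algebra_simps power2_eq_square)

lemma D_linear: "linear (D s)"
  by (rule linearI; unfold D_eq; rule euclidean_eqI) (simp_all add: jp_simps algebra_simps)

lemma D_D: "D s (D t x) = D (s * t) x"
proof -
  obtain x1 xh x0 where x: "x = x1 + xh + x0" "c \<odot> x1 = x1" "c \<odot> xh = (1/2) *\<^sub>R xh" "c \<odot> x0 = 0"
    using peirce_decomp[OF c_idem] .
  show ?thesis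
    using D_peirce[of x1 xh x0] D_peirce[of "t\<^sup>2 *\<^sub>R x1" "t *\<^sub>R xh" x0] x
    by (simp add: jp_simps power_mult_distrib)
qed

lemma D_1: "D 1 x = x"
  by (simp add: D_eq)

lemma D_self_adjoint: "B (D s x) y = B x (D s y)"
  by (simp add: D_eq B_simps B_assoc_left)

lemma peirce_one_part_eq: "2 *\<^sub>R (c \<odot> (c \<odot> x)) - c \<odot> x = B c x *\<^sub>R c"
proof -
  obtain k where k: "2 *\<^sub>R (c \<odot> (c \<odot> x)) - c \<odot> x = k *\<^sub>R c"
    using prim_peirce_1[OF c peirce_one_part[OF c_idem]] .
  have "B c (c \<odot> y) = B c y" for y by (metis B_assoc c_idem)
  then have "B c (2 *\<^sub>R (c \<odot> (c \<odot> x)) - c \<odot> x) = B c x" by (simp add: B_simps)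
  then show ?thesis unfolding k by (simp add: B_simps B_prim c)
qed

lemma D_e: "D s e = e + (s\<^sup>2 - 1) *\<^sub>R c"
  unfolding D_eq
  by (simp add: unit c_idem, rule euclidean_eqI) (simp add: algebra_simps power2_eq_square)

lemma B_c_D: "B c (D s x) = s\<^sup>2 * B c x"
proof -
  have "D s c = s\<^sup>2 *\<^sub>R c" using D_peirce[of c 0 0] c_idem by (simp add: jp_simps)
  then show ?thesis by (simp add: D_self_adjoint[symmetric] B_simps)
qed

text \<open>The Peirce relations between \<open>c\<close> and \<open>d\<close> make \<open>D s d\<close> a positive multiple of an idempotent.\<close>

lemma D_prim_K:
  assumes d: "prim d" and s: "s > 0"
  shows "D s d \<in> K"
proof -
  obtain l u w where p: "d = l *\<^sub>R c + u + w" "c \<odot> u = (1/2) *\<^sub>R u" "c \<odot> w = 0"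
    "u \<odot> u = (l * (1 - l)) *\<^sub>R c + l *\<^sub>R w" "2 *\<^sub>R (u \<odot> w) = (1 - l) *\<^sub>R u" "w \<odot> w = (1 - l) *\<^sub>R w"
    "B c d = l * B c c"
    using prim_pair[OF c d] by metis
  have l: "B c d = l" using p B_prim[OF c] by simp
  have l0: "0 \<le> l" using K_B_nonneg[OF prim_in_K[OF c] prim_in_K[OF d]] l by simp
  have l1: "l \<le> 1" using B_Cauchy_Schwarz[of c d] l B_prim[OF c] B_prim[OF d] by simp
  define k where "k = s\<^sup>2 * l + (1 - l)"
  have k: "k > 0"
  proof (cases "l = 1")
    case True
    then show ?thesis using s by (simp add: k_def)
  next
    case False
    then show ?thesis using l0 l1 by (auto simp: k_def intro!: add_nonneg_pos)
  qed
  define g where "g = D s d"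
  have g: "g = (s\<^sup>2 * l) *\<^sub>R c + s *\<^sub>R u + w"
    unfolding g_def p(1) using D_peirce[of "l *\<^sub>R c" u w s] p c_idem by (simp add: jp_simps)
  have uc: "u \<odot> c = (1/2) *\<^sub>R u" "w \<odot> c = 0" "w \<odot> u = u \<odot> w"
    using p by (simp_all add: commute)
  have uw: "u \<odot> w = ((1 - l) / 2) *\<^sub>R u"
  proof -
    have "u \<odot> w = (1/2) *\<^sub>R (2 *\<^sub>R (u \<odot> w))" by simp
    then show ?thesis unfolding p(5) by simp
  qed
  have "g \<odot> g = k *\<^sub>R g"
    unfolding g
    by (simp add: jp_simps c_idem p(2,3) uc, simp add: p(4,6) uw, rule euclidean_eqI)
      (simp add: k_def algebra_simps power2_eq_square)
  then have "(1 / sqrt k) *\<^sub>R g \<odot> (1 / sqrt k) *\<^sub>R g = g"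
    using k by (simp add: jp_simps)
  then have "g \<in> range (\<lambda>x. x \<odot> x)"
    using rangeI[of "\<lambda>x. x \<odot> x" "(1 / sqrt k) *\<^sub>R g"] by (simp only:)
  then show ?thesis by (simp add: squares_eq g_def)
qed

text \<open>Self-adjointness moves \<open>D s\<close> onto \<open>d\<close>; \<open>x - m e\<close>
  pairs nonnegatively with \<open>D s d\<close>, and
  \<open>B e (D s d) = 1 + (s^2 - 1) B c d\<close> is at least 1. One margin thus serves the whole
  path, which keeps the error terms uniform.\<close>

lemma D_lower_bound:
  assumes x: "\<And>d. prim d \<Longrightarrow> m \<le> B x d" and m: "m > 0" and s: "s \<ge> 1" and d: "prim d"
  shows "m \<le> B (D s x) d"
proof -
  have "x - m *\<^sub>R e \<in> K" using x by (auto simp: K_def B_simps B_e_prim)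
  then have "0 \<le> B (x - m *\<^sub>R e) (D s d)" using D_prim_K[OF d] s by (intro K_B_nonneg) auto
  then have "m * B e (D s d) \<le> B (D s x) d" by (simp add: B_simps D_self_adjoint)
  moreover have "B e (D s d) = 1 + (s\<^sup>2 - 1) * B c d"
    by (simp add: D_self_adjoint[symmetric] D_e B_simps B_e_prim d)
  moreover have "0 \<le> (s\<^sup>2 - 1) * B c d"
    using s K_B_nonneg[OF prim_in_K[OF c] prim_in_K[OF d]] by (intro mult_nonneg_nonneg) auto
  ultimately show ?thesis using m by (smt (verit) mult_le_cancel_left1)
qed

lemma D_jcone:
  assumes "x \<in> jcone jp" "s \<ge> 1"
  shows "D s x \<in> jcone jp"
  using assms D_lower_bound unfolding jcone_eq by blast

text \<open>Tangent inequality at \<open>y\<close> with its inverse \<open>z\<close>: the term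
  \<open>B z (c \<odot> y) = B e c = 1\<close> produces \<open>2 (t - 1)\<close>, and the
  1-component \<open>B c y\<close> times \<open>c\<close> of \<open>y\<close> produces the quadratic
  remainder.\<close>

lemma log_det_step:
  assumes y: "y \<in> jcone jp" "\<And>d. prim d \<Longrightarrow> m \<le> B y d" "m > 0" and Dy: "D t y \<in> jcone jp"
  shows "ln (jdet jp e (D t y)) \<le> ln (jdet jp e y) + 2 * (t - 1) + (t - 1)\<^sup>2 * (B c y / m)"
proof -
  obtain z where z: "y \<odot> z = e" "z \<in> K"
    "\<And>m d. 0 < m \<Longrightarrow> (\<And>d. prim d \<Longrightarrow> m \<le> B y d) \<Longrightarrow> prim d \<Longrightarrow> B z d \<le> 1 / m"
    "\<And>x. x \<in> jcone jp \<Longrightarrow> ln (jdet jp e x) \<le> ln (jdet jp e y) + B z x - real r"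
    using log_det_tangent[OF y(1)] by blast
  have "B z (c \<odot> y) = B (y \<odot> z) c" using B_assoc[of z y c] by (simp add: commute[of y])
  then have "B z (c \<odot> y) = 1" using z B_e_prim[OF c] by simp
  moreover have "B z y = real r" using B_unit[of z y] z by (simp add: commute B_e_e)
  ultimately have "B z (D t y) = real r + 2 * (t - 1) + (t - 1)\<^sup>2 * (B c y * B z c)"
    by (simp add: D_eq peirce_one_part_eq B_simps)
  moreover have "B c y * B z c \<le> B c y / m"
    using mult_left_mono[OF z(3)[OF y(3,2) c], of "B c y"] K_B_nonneg[OF prim_in_K[OF c] jcone_K[OF y(1)]]
    by simp
  then have "(t - 1)\<^sup>2 * (B c y * B z c) \<le> (t - 1)\<^sup>2 * (B c y / m)" by (intro mult_left_mono) auto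
  ultimately show ?thesis using z(4)[OF Dy] by simp
qed

lemma log_det_D:
  assumes x: "x \<in> jcone jp" and s: "s \<ge> 1"
  shows "ln (jdet jp e x) + 2 * ln s \<le> ln (jdet jp e (D s x))"
proof -
  obtain m where m: "m > 0" "\<And>d. prim d \<Longrightarrow> m \<le> B x d" using x by (auto simp: jcone_eq)
  \<comment> \<open>Bounds the coefficient of the quadratic remainder at every point of the path,
    since \<open>B c (D t x) = t^2 B c x\<close> and \<open>t\<close> is at most
    \<open>s\<close>.\<close>
  define C where "C = s\<^sup>2 * B c x / m"
  have cx: "B c x \<ge> 0" by (rule K_B_nonneg[OF prim_in_K[OF c] jcone_K[OF x]])
  have bound: "ln (jdet jp e x) \<le> ln (jdet jp e (D s x))
      + real n * (2 * (exp (- ln s / real n) - 1) + (exp (- ln s / real n) - 1)\<^sup>2 * C)"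
    if n: "n > 0" for n
  proof -
    define q where "q = exp (ln s / real n)"
    define h where "h = 2 * (exp (- ln s / real n) - 1) + (exp (- ln s / real n) - 1)\<^sup>2 * C"
    have q1: "q \<ge> 1" using s by (simp add: q_def)
    have inv: "exp (- ln s / real n) = 1 / q" by (simp add: q_def exp_minus field_simps)
    have qn: "q ^ n = s" using n s by (simp add: q_def exp_of_nat_mult[symmetric])
    \<comment> \<open>The tangent inequality bounds ln det from above, so the step goes backwards:
      the tangent is taken at the later point and evaluated at the earlier one, with factor
      \<open>1 / q\<close>.\<close>
    have step: "ln (jdet jp e (D (q ^ k) x)) \<le> ln (jdet jp e (D (q ^ Suc k) x)) + h" if k: "k < n" for k
    proof -
      let ?y = "D (q ^ Suc k) x"
      have qk: "1 \<le> q ^ k" "1 \<le> q ^ Suc k" using q1 one_le_power by blast+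
      have y: "?y \<in> jcone jp" "\<And>d. prim d \<Longrightarrow> m \<le> B ?y d"
        using D_jcone[OF x qk(2)] D_lower_bound[OF m(2,1) qk(2)] by auto
      have Dy: "D (1 / q) ?y = D (q ^ k) x" using q1 by (simp add: D_D)
      have "q ^ Suc k \<le> s" unfolding qn[symmetric] using q1 k by (intro power_increasing) auto
      then have "(q ^ Suc k)\<^sup>2 \<le> s\<^sup>2" using qk by (intro power_mono) auto
      then have "B c ?y / m \<le> C"
        unfolding C_def B_c_D using m cx by (intro divide_right_mono mult_right_mono) auto
      then have "(1 / q - 1)\<^sup>2 * (B c ?y / m) \<le> (1 / q - 1)\<^sup>2 * C" by (intro mult_left_mono) auto
      then show ?thesis
        using log_det_step[OF y(1,2) m(1), of "1 / q"] D_jcone[OF x qk(1)] unfolding Dy h_def inv by simp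
    qed
    have "ln (jdet jp e x) \<le> ln (jdet jp e (D (q ^ k) x)) + real k * h" if "k \<le> n" for k
      using that
    proof (induction k)
      case 0
      then show ?case by (simp add: D_1)
    next
      case (Suc k)
      then show ?case using step[of k] by (simp add: algebra_simps)
    qed
    from this[of n] show ?thesis by (simp add: qn h_def)
  qed
  define L where "L = ln s"
  show ?thesis
  proof (cases "s = 1")
    case True
    then show ?thesis by (simp add: D_1)
  next
    case False
    then have L: "L > 0" using s by (simp add: L_def)
    \<comment> \<open>Each of the n steps contributes -2 L / n to first order, while the n
      remainders, of order 1 / n^2 each, vanish in the limit.\<close>
    have "(\<lambda>n. 2 * (real n * (exp (- L / real n) - 1)) + C * (real n * (exp (- L / real n) - 1)\<^sup>2))
        \<longlonglongrightarrow> 2 * (- L) + C * 0"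
      by (intro tendsto_intros; use L in real_asymp)
    then have "(\<lambda>n. real n * (2 * (exp (- L / real n) - 1) + (exp (- L / real n) - 1)\<^sup>2 * C)) \<longlonglongrightarrow> - 2 * L"
      by (simp add: algebra_simps)
    then have "((\<lambda>n. ln (jdet jp e (D s x))
        + real n * (2 * (exp (- L / real n) - 1) + (exp (- L / real n) - 1)\<^sup>2 * C))
        \<longlongrightarrow> ln (jdet jp e (D s x)) + (- 2 * L)) sequentially"
      by (rule tendsto_add[OF tendsto_const])
    moreover have "\<forall>\<^sub>F n in sequentially. ln (jdet jp e x) \<le> ln (jdet jp e (D s x))
        + real n * (2 * (exp (- L / real n) - 1) + (exp (- L / real n) - 1)\<^sup>2 * C)"
      using eventually_gt_at_top[of 0] by eventually_elim (use bound in \<open>simp add: L_def\<close>)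
    ultimately have "ln (jdet jp e x) \<le> ln (jdet jp e (D s x)) + (- 2 * L)"
      by (rule tendsto_lowerbound) simp
    then show ?thesis by (simp add: L_def)
  qed
qed

lemma jdet_D:
  assumes x: "x \<in> jcone jp" and s: "s \<ge> 1"
  shows "s\<^sup>2 * jdet jp e x \<le> jdet jp e (D s x)"
proof -
  have p: "0 < jdet jp e x" "0 < jdet jp e (D s x)" using jdet_pos D_jcone x s by auto
  have "ln (s\<^sup>2 * jdet jp e x) \<le> ln (jdet jp e (D s x))"
    using log_det_D[OF x s] p s by (simp add: ln_mult ln_realpow)
  then show ?thesis using p s by (subst (asm) ln_le_cancel_iff) auto
qed

text \<open>The Peirce components are orthogonal, so the left side is
  \<open>s^4 l^2 + s^2 B u u + B w w\<close>; it is re-expressed through \<open>B c x = l\<close>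
  and \<open>B c (x \<odot> x) = l^2 + B u u / 2\<close>.\<close>

lemma B_D_D: "B (D s x) (D s x) = B x x + 2 * (s\<^sup>2 - 1) * B c (x \<odot> x) + (s\<^sup>2 - 1)\<^sup>2 * (B c x)\<^sup>2"
proof -
  obtain x1 u w where x: "x = x1 + u + w" "c \<odot> x1 = x1" "c \<odot> u = (1/2) *\<^sub>R u" "c \<odot> w = 0"
    using peirce_decomp[OF c_idem] .
  obtain l where l: "x1 = l *\<^sub>R c" using prim_peirce_1[OF c x(2)] .
  have o: "B c u = 0" "B u c = 0" "B c w = 0" "B w c = 0" "B u w = 0" "B w u = 0"
    using B_eigen_orthogonal[of c c 1 u "1/2"] B_eigen_orthogonal[of c u "1/2" c 1]
      B_eigen_orthogonal[of c c 1 w 0] B_eigen_orthogonal[of c w 0 c 1]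
      B_eigen_orthogonal[of c u "1/2" w 0] B_eigen_orthogonal[of c w 0 u "1/2"] c_idem x by auto
  have "D s x = (s\<^sup>2 * l) *\<^sub>R c + s *\<^sub>R u + w"
    unfolding x(1) using D_peirce[OF x(2-4)] by (simp add: l)
  then have "B (D s x) (D s x) = (s\<^sup>2 * l)\<^sup>2 + s\<^sup>2 * B u u + B w w"
    by (simp add: B_simps o B_prim[OF c] power2_eq_square)
  moreover have "B x x = l\<^sup>2 + B u u + B w w" "B c x = l"
    by (simp_all add: x(1) l B_simps o B_prim[OF c] power2_eq_square)
  moreover have "B c (x \<odot> x) = B (c \<odot> x) x" by (simp add: B_assoc)
  moreover have "c \<odot> x = l *\<^sub>R c + (1/2) *\<^sub>R u" unfolding x(1) l by (simp add: jp_simps c_idem x)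
  then have "B (c \<odot> x) x = l\<^sup>2 + B u u / 2"
    by (simp add: x(1) l B_simps o B_prim[OF c] power2_eq_square)
  ultimately show ?thesis by (simp add: algebra_simps power2_eq_square)
qed

text \<open>Each eigenvalue of \<open>x\<close> is at most the Frobenius norm of \<open>x\<close>,
  so that norm times \<open>x\<close> minus the square of \<open>x\<close> lies in the cone.\<close>

lemma B_square_bound:
  assumes "x \<in> K"
  shows "B c (x \<odot> x) \<le> sqrt (B x x) * B c x"
proof -
  obtain l b where b: "frame b" "x = (\<Sum>i<r. l i *\<^sub>R b i)" using spectral_frame .
  have l: "\<And>i. i < r \<Longrightarrow> 0 \<le> l i" using assms b frame_K by blast
  have xx: "B x x = (\<Sum>i<r. (l i)\<^sup>2)" by (simp add: b frame_B power2_eq_square)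
  have "B c (x \<odot> x) = (\<Sum>i<r. l i * (l i * B c (b i)))"
    by (simp add: b frame_mult B_sum_right B_simps mult.assoc)
  also have "\<dots> \<le> (\<Sum>i<r. sqrt (B x x) * (l i * B c (b i)))"
  proof (intro sum_mono mult_right_mono)
    fix i assume i: "i \<in> {..<r}"
    have "(l i)\<^sup>2 \<le> B x x" unfolding xx using i by (intro member_le_sum) auto
    then show "l i \<le> sqrt (B x x)" by (rule real_le_rsqrt)
    show "0 \<le> l i * B c (b i)"
      using l i K_B_nonneg prim_in_K frame_prim[OF b(1)] c by auto
  qed
  also have "\<dots> = sqrt (B x x) * B c x"
    by (simp add: b(2) B_sum_right B_simps sum_distrib_left)
  finally show ?thesis .
qed

text \<open>The point is that \<open>z0 = z - l c\<close> lies in \<open>K\<close>. Since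
  \<open>c \<odot> z0 = 0\<close>, also \<open>c\<close> annihilates the square of
  \<open>z0\<close>, so frame members of \<open>z0\<close> with nonzero eigenvalue are orthogonal to
  \<open>c\<close>. Their eigenvalues are therefore values \<open>B z (d i)\<close>, which are
  nonnegative.\<close>

lemma eigen_lower_bound:
  assumes z: "z \<in> K" "z \<odot> c = l *\<^sub>R c" and x: "x \<in> K"
  shows "l * B c x \<le> B z x"
proof -
  define z0 where "z0 = z - l *\<^sub>R c"
  have cz: "c \<odot> z0 = 0" using z c_idem by (simp add: z0_def jp_simps commute)
  obtain m d where d: "frame d" "z0 = (\<Sum>i<r. m i *\<^sub>R d i)" using spectral_frame .
  have "c \<odot> (z0 \<odot> z0) = 0" by (rule peirce_00[OF c_idem cz cz])
  then have "B c (z0 \<odot> z0) = 0" using B_unit[of c "z0 \<odot> z0"] by (simp add: B_simps)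
  then have sum0: "(\<Sum>i<r. (m i)\<^sup>2 * B c (d i)) = 0"
    by (simp add: d frame_mult B_sum_right B_simps power2_eq_square)
  have cd: "0 \<le> B c (d i)" if "i < r" for i
    using K_B_nonneg prim_in_K frame_prim[OF d(1) that] c by blast
  have "m i \<ge> 0" if i: "i < r" for i
  proof (cases "m i = 0")
    case False
    have "(m i)\<^sup>2 * B c (d i) = 0"
      using sum0 cd i by (subst (asm) sum_nonneg_eq_0_iff) auto
    then have "B c (d i) = 0" using False by simp
    then have "m i = B z (d i)"
      using frame_B_single[OF d(1) i, of m] by (simp add: d(2)[symmetric] z0_def B_simps)
    then show ?thesis using z frame_prim[OF d(1) i] by (simp add: K_def)
  qed simp
  then have "z0 \<in> K" using frame_K d by blast
  then have "0 \<le> B z0 x" using x by (rule K_B_nonneg)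
  then show ?thesis by (simp add: z0_def B_simps)
qed

end

subsection \<open>The condition measure\<close>

text \<open>Links the ambient norm, in which compactness is available, to the form \<open>B\<close>,
  in which the slice is bounded.\<close>

lemma B_coercive:
  obtains k where "k > 0" "\<And>x. k * (norm x)\<^sup>2 \<le> B x x"
proof -
  let ?S = "sphere (0::'a) 1"
  obtain b :: 'a where "b \<in> Basis" using nonempty_Basis by blast
  then have "b \<in> ?S" by simp
  then have "\<exists>u\<in>?S. \<forall>v\<in>?S. B u u \<le> B v v"
    by (intro continuous_attains_inf continuous_on_B continuous_on_id) auto
  then obtain u where u: "u \<in> ?S" "\<And>v. v \<in> ?S \<Longrightarrow> B u u \<le> B v v" by blast
  have "B u u * (norm x)\<^sup>2 \<le> B x x" for x
  proof (cases "x = 0")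
    case False
    have "B u u \<le> B ((1 / norm x) *\<^sub>R x) ((1 / norm x) *\<^sub>R x)" using False by (intro u) simp
    then show ?thesis using False by (simp add: B_simps power2_eq_square field_simps)
  qed (simp add: B_simps)
  moreover have "B u u > 0" using u by (intro B_pos) auto
  ultimately show ?thesis using that by blast
qed

text \<open>The determinant is upper semicontinuous at every \<open>x\<close> of the closed cone: bound it by its
  tangent at \<open>x + t e\<close>, which lies in the open cone, and let \<open>t\<close> tend to \<open>0\<close>.\<close>

lemma jdet_limit_le:
  assumes X: "\<And>n. X n \<in> jcone jp" "X \<longlonglongrightarrow> x" and x: "x \<in> K"
    and s: "(\<lambda>n. jdet jp e (X n)) \<longlonglongrightarrow> s" "s > 0"
  shows "x \<in> jcone jp" "s \<le> jdet jp e x"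
proof -
  obtain l c where c: "frame c" "x = (\<Sum>i<r. l i *\<^sub>R c i)" using spectral_frame .
  have l: "\<And>i. i < r \<Longrightarrow> 0 \<le> l i" using x c frame_K by blast
  have le: "s \<le> (\<Prod>i<r. l i + t)" if t: "t > 0" for t
  proof -
    define y where "y = (\<Sum>i<r. (l i + t) *\<^sub>R c i)"
    have lt: "\<forall>i<r. 0 < l i + t" using l t by (simp add: add_nonneg_pos)
    have y: "y \<in> jcone jp" unfolding y_def frame_jcone[OF c(1)] by (rule lt)
    have yx: "x = y - t *\<^sub>R e"
      using c by (simp add: y_def scaleR_left_distrib sum.distrib scaleR_sum_right[symmetric] jordan_frame_def)
    obtain z where z: "y \<odot> z = e" "z \<in> K"
      "\<And>w. w \<in> jcone jp \<Longrightarrow> ln (jdet jp e w) \<le> ln (jdet jp e y) + B z w - real r"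
      using log_det_tangent[OF y] by metis
    have "(\<lambda>n. ln (jdet jp e (X n))) \<longlonglongrightarrow> ln s" using s by (intro tendsto_ln) auto
    moreover have "(\<lambda>n. ln (jdet jp e y) + B z (X n) - real r) \<longlonglongrightarrow> ln (jdet jp e y) + B z x - real r"
    proof (intro tendsto_intros)
      show "(\<lambda>n. B z (X n)) \<longlonglongrightarrow> B z x"
        using B_linear[of z] X(2) unfolding linear_conv_bounded_linear by (rule bounded_linear.tendsto)
    qed
    ultimately have "ln s \<le> ln (jdet jp e y) + B z x - real r"
      by (rule LIMSEQ_le) (use z(3) X(1) in blast)
    moreover have "B z y = real r" using B_unit[of z y] z by (simp add: commute B_e_e)
    moreover have "0 \<le> t * B z e" using K_B_nonneg[OF z(2) jcone_K[OF e_in_jcone]] t by simp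
    ultimately have "ln s \<le> ln (jdet jp e y)" by (simp add: yx B_simps)
    then have "s \<le> jdet jp e y" using s jdet_pos[OF y] by (subst (asm) ln_le_cancel_iff) auto
    then show ?thesis unfolding y_def jdet_frame[OF c(1) lt] .
  qed
  have "((\<lambda>t. \<Prod>i<r. l i + t) \<longlongrightarrow> (\<Prod>i<r. l i + 0)) (at_right 0)"
    by (intro tendsto_intros)
  then have "s \<le> (\<Prod>i<r. l i + 0)"
    by (rule tendsto_lowerbound) (auto intro!: eventually_at_right_less[THEN eventually_mono] le)
  then have s_le: "s \<le> (\<Prod>i<r. l i)" by simp
  have l_pos: "\<forall>i<r. 0 < l i"
  proof (intro allI impI)
    fix i assume i: "i < r"
    have "l i \<noteq> 0"
    proof
      assume "l i = 0"
      then have "(\<Prod>i<r. l i) = 0" using i by (intro prod_zero) auto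
      with s_le s(2) show False by simp
    qed
    with l[OF i] show "0 < l i" by simp
  qed
  show "x \<in> jcone jp" unfolding c(2) frame_jcone[OF c(1)] by (rule l_pos)
  show "s \<le> jdet jp e x" unfolding c(2) jdet_frame[OF c(1) l_pos] by (rule s_le)
qed

lemma jcone_nonzero:
  assumes "x \<in> jcone jp"
  shows "x \<noteq> 0"
proof -
  obtain b where "frame b" using jeig_frame .
  then have "prim (b 0)" using frame_prim r_pos by blast
  then have "0 < B x (b 0)" using assms by (auto simp: jcone_eq dest: less_le_trans)
  then show ?thesis by (auto simp: B_simps)
qed

lemma B_normalize:
  assumes "B x x > 0"
  shows "B (sqrt (real r / B x x) *\<^sub>R x) (sqrt (real r / B x x) *\<^sub>R x) = real r"
proof -
  have "B (t *\<^sub>R x) (t *\<^sub>R x) = t * t * B x x" for t by (simp add: B_simps)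
  then show ?thesis using assms by simp
qed

text \<open>The slice of the open cone is not compact, so a maximizing sequence converges only
  within the closed cone \<open>K\<close>. Its determinants tend to a positive number, which forces
  the limit back into the open cone.\<close>

lemma jdet_attains_max:
  assumes M: "subspace M" "M \<inter> jcone jp \<noteq> {}"
  obtains x where "x \<in> M \<inter> jcone jp" "B x x = real r"
    "\<And>y. y \<in> M \<inter> jcone jp \<Longrightarrow> B y y = real r \<Longrightarrow> jdet jp e y \<le> jdet jp e x"
proof -
  define S where "S = {x \<in> M \<inter> jcone jp. B x x = real r}"
  have "S \<noteq> {}"
  proof -
    obtain x where x: "x \<in> M" "x \<in> jcone jp" using M by blast
    have p: "B x x > 0" by (rule B_pos[OF jcone_nonzero[OF x(2)]])
    let ?t = "sqrt (real r / B x x)"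
    have t: "?t > 0" using p r_pos by simp
    have "?t *\<^sub>R x \<in> S"
      using x M scale_jcone[OF x(2) t] B_normalize[OF p] by (simp add: S_def subspace_scale)
    then show ?thesis by blast
  qed
  then obtain x0 where x0: "x0 \<in> S" by blast
  obtain z where z: "\<And>y. y \<in> jcone jp \<Longrightarrow> ln (jdet jp e y) \<le> ln (jdet jp e e) + B z y - real r"
    using log_det_tangent[OF e_in_jcone] by metis
  \<comment> \<open>Boundedness: the tangent of ln det at \<open>e\<close> is linear in
    \<open>y\<close>, and \<open>y\<close> has fixed length.\<close>
  have "jdet jp e y \<le> exp (ln (jdet jp e e) + sqrt (B z z) * sqrt (real r))" if "y \<in> S" for y
  proof -
    have y: "y \<in> jcone jp" "B y y = real r" using that by (auto simp: S_def)
    have "ln (jdet jp e y) \<le> ln (jdet jp e e) + sqrt (B z z) * sqrt (real r)"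
      using z[OF y(1)] B_Cauchy_Schwarz[of z y] y(2) by simp
    then show ?thesis using jdet_pos[OF y(1)] by (metis exp_le_cancel_iff exp_ln)
  qed
  then have bdd: "bdd_above (jdet jp e ` S)" by (intro bdd_aboveI2)
  define s where "s = (SUP y\<in>S. jdet jp e y)"
  have upper: "jdet jp e y \<le> s" if "y \<in> S" for y
    unfolding s_def using that bdd by (rule cSUP_upper)
  have s_pos: "s > 0" using upper[OF x0] jdet_pos[of x0] x0 by (simp add: S_def)
  have "\<exists>y\<in>S. s - 1 / real (Suc n) < jdet jp e y" for n
    using less_cSUP_iff[of S "jdet jp e" "s - 1 / real (Suc n)"] bdd x0 unfolding s_def by auto
  then obtain X where X: "\<And>n. X n \<in> S" "\<And>n. s - 1 / real (Suc n) < jdet jp e (X n)" by metis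
  have lim: "(\<lambda>n. jdet jp e (X n)) \<longlonglongrightarrow> s"
  proof (rule tendsto_sandwich)
    show "(\<lambda>n. s - 1 / real (Suc n)) \<longlonglongrightarrow> s" by real_asymp
    show "(\<lambda>n. s) \<longlonglongrightarrow> s" by simp
  qed (use X upper in \<open>auto intro!: always_eventually less_imp_le\<close>)
  let ?T = "M \<inter> K \<inter> {x. B x x = real r}"
  obtain k where k: "k > 0" "\<And>x. k * (norm x)\<^sup>2 \<le> B x x" using B_coercive by blast
  have "bounded ?T"
  proof (rule boundedI)
    fix x assume "x \<in> ?T"
    then have "(norm x)\<^sup>2 \<le> real r / k" using k(1) k(2)[of x] by (simp add: field_simps)
    then show "norm x \<le> sqrt (real r / k)" by (rule real_le_rsqrt)
  qed
  moreover have "closed {x. B x x = real r}"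
    by (intro closed_Collect_eq continuous_on_const continuous_on_B continuous_on_id)
  ultimately have "compact ?T"
    using M closed_K by (simp add: compact_eq_bounded_closed closed_Int closed_subspace)
  moreover have "\<forall>n. X n \<in> ?T" using X jcone_K by (auto simp: S_def)
  ultimately obtain x f where x: "x \<in> ?T" "strict_mono (f :: nat \<Rightarrow> nat)" "(X \<circ> f) \<longlonglongrightarrow> x"
    unfolding compact_def by meson
  have XJ: "(X \<circ> f) n \<in> jcone jp" for n using X by (simp add: S_def)
  have "(\<lambda>n. jdet jp e ((X \<circ> f) n)) \<longlonglongrightarrow> s"
    using LIMSEQ_subseq_LIMSEQ[OF lim x(2)] by (simp add: o_def)
  with jdet_limit_le[OF XJ x(3)] x(1) s_pos have "x \<in> jcone jp" "s \<le> jdet jp e x" by auto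
  then show ?thesis using that[of x] x(1) upper by (force simp: S_def)
qed

lemma jdelta:
  assumes M: "subspace M" "M \<inter> jcone jp \<noteq> {}"
  obtains x where "x \<in> M \<inter> jcone jp" "B x x = real r" "jdelta jp e (M \<inter> jcone jp) = jdet jp e x"
    "\<And>y. y \<in> M \<inter> jcone jp \<Longrightarrow> B y y = real r \<Longrightarrow> jdet jp e y \<le> jdelta jp e (M \<inter> jcone jp)"
proof -
  obtain x where x: "x \<in> M \<inter> jcone jp" "B x x = real r"
    "\<And>y. y \<in> M \<inter> jcone jp \<Longrightarrow> B y y = real r \<Longrightarrow> jdet jp e y \<le> jdet jp e x"
    using jdet_attains_max[OF M] by blast
  have "jdelta jp e (M \<inter> jcone jp) = jdet jp e x"
    unfolding jdelta_def using x by (intro Greatest_equality) (auto simp: jnorm_F_eq B_nonneg)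
  then show ?thesis using that[of x] x by auto
qed

text \<open>Rescaling \<open>y\<close> to squared length \<open>r\<close> uses a factor of at least
  \<open>1 / k\<close>, and the determinant is homogeneous of degree \<open>r\<close>.\<close>

lemma jdelta_lower_bound:
  assumes M: "subspace M" and y: "y \<in> M \<inter> jcone jp" and k: "B y y \<le> real r * k\<^sup>2" "k > 0"
  shows "jdet jp e y / k ^ r \<le> jdelta jp e (M \<inter> jcone jp)"
proof -
  have p: "B y y > 0" using y by (intro B_pos jcone_nonzero) auto
  let ?t = "sqrt (real r / B y y)"
  have t: "?t > 0" using p r_pos by simp
  have "1 / k\<^sup>2 \<le> real r / B y y" using k p by (simp add: field_simps)
  then have kt: "1 / k \<le> ?t"
    by (intro real_le_rsqrt) (simp add: power_divide)
  have "jdet jp e y / k ^ r = (1 / k) ^ r * jdet jp e y" by (simp add: power_divide)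
  also have "\<dots> \<le> ?t ^ r * jdet jp e y"
    using kt k jdet_pos[of y] y by (intro mult_right_mono power_mono) auto
  also have "\<dots> = jdet jp e (?t *\<^sub>R y)" using scale_jcone[OF _ t] y by simp
  also have "\<dots> \<le> jdelta jp e (M \<inter> jcone jp)"
  proof -
    obtain x where "\<And>y. y \<in> M \<inter> jcone jp \<Longrightarrow> B y y = real r \<Longrightarrow> jdet jp e y \<le> jdelta jp e (M \<inter> jcone jp)"
      using jdelta[OF M] y by blast
    moreover have "?t *\<^sub>R y \<in> M \<inter> jcone jp" "B (?t *\<^sub>R y) (?t *\<^sub>R y) = real r"
      using y M scale_jcone[OF _ t] B_normalize[OF p] by (simp_all add: subspace_scale)
    ultimately show ?thesis by blast
  qed
  finally show ?thesis .
qed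

section \<open>Estimate for the image of the subspace\<close>

lemma jnorm_inf_K:
  assumes z: "z \<in> K" "z \<noteq> 0"
  shows "jnorm_inf jp e z = jlambda_max jp e z" "0 < jlambda_max jp e z"
proof -
  obtain b where b: "frame b" "z = (\<Sum>i<r. jeig jp e z i *\<^sub>R b i)" using jeig_frame .
  then have l: "\<forall>i<r. 0 \<le> jeig jp e z i" using z frame_K by metis
  then have "(\<lambda>i. \<bar>jeig jp e z i\<bar>) ` {..<r} = jeig jp e z ` {..<r}" by (intro image_cong) auto
  then show "jnorm_inf jp e z = jlambda_max jp e z" by (simp add: jnorm_inf_def jlambda_max_def)
  have "\<exists>i<r. jeig jp e z i \<noteq> 0"
  proof (rule ccontr)
    assume "\<not> (\<exists>i<r. jeig jp e z i \<noteq> 0)"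
    then have "(\<Sum>i<r. jeig jp e z i *\<^sub>R b i) = 0" by (intro sum.neutral) auto
    with b z show False by simp
  qed
  then obtain i where i: "i < r" "jeig jp e z i > 0" using l by force
  then have "jeig jp e z i \<le> jlambda_max jp e z" unfolding jlambda_max_def by (intro Max_ge) auto
  with i show "0 < jlambda_max jp e z" by simp
qed

lemma jdelta_jquad:
  assumes L: "subspace L" "L \<inter> jcone jp \<noteq> {}"
    and z: "z \<in> closure (jcone jp) - {0}"
    and small: "jnorm_F jp e (jpos_part jp e (jproj jp e L z)) \<le> \<epsilon> * jnorm_inf jp e z"
    and c: "prim c" and zc: "z \<odot> c = jlambda_max jp e z *\<^sub>R c" and a: "a > 0"
  shows "(1 + a)\<^sup>2 / (1 + (2 * a + a\<^sup>2) * \<epsilon>) ^ r * jdelta jp e (L \<inter> jcone jp)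
    \<le> jdelta jp e (jquad jp (e + a *\<^sub>R c) ` L \<inter> jcone jp)"
proof -
  let ?k = "2 * a + a\<^sup>2" and ?l = "jlambda_max jp e z" and ?D = "D c (1 + a)"
  define p where "p = jpos_part jp e (jproj jp e L z)"
  have zK: "z \<in> K" "z \<noteq> 0" using z closure_jcone by auto
  have l: "0 < ?l" using jnorm_inf_K[OF zK] by simp
  have small': "sqrt (B p p) \<le> \<epsilon> * ?l"
    using small jnorm_inf_K[OF zK] by (simp add: jnorm_F_eq p_def)
  \<comment> \<open>The hypothesis bounds a norm by \<open>\<epsilon> * ?l\<close> with
    \<open>?l\<close> positive, which forces the sign of \<open>\<epsilon>\<close>.\<close>
  have "0 \<le> \<epsilon> * ?l" using small' B_nonneg[of p] by (meson order_trans real_sqrt_ge_zero)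
  then have eps: "0 \<le> \<epsilon>" using l by (simp add: zero_le_mult_iff)
  obtain x where x: "x \<in> L" "x \<in> jcone jp" "B x x = real r" "jdelta jp e (L \<inter> jcone jp) = jdet jp e x"
    using jdelta[OF L] by blast
  have xK: "x \<in> K" using x jcone_K by blast
  have cx0: "0 \<le> B c x" by (rule K_B_nonneg[OF prim_in_K[OF c] xK])
  \<comment> \<open>Membership of \<open>x\<close> in \<open>L\<close> replaces \<open>z\<close> by
    its projection, and membership in the cone replaces the projection by its positive part;
    Cauchy-Schwarz then brings in the hypothesis.\<close>
  have "?l * B c x \<le> B z x" by (rule eigen_lower_bound[OF c zK(1) zc xK])
  also have "\<dots> = B (jproj jp e L z) x" using jproj(2)[OF L(1) x(1), of z] by (simp add: B_simps)
  also have "\<dots> \<le> B p x" unfolding p_def by (rule jpos_part(2)[OF xK])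
  also have "\<dots> \<le> sqrt (B p p) * sqrt (real r)" using B_Cauchy_Schwarz[of p x] x(3) by simp
  also have "\<dots> \<le> \<epsilon> * ?l * sqrt (real r)" using small' by (intro mult_right_mono) auto
  finally have "?l * B c x \<le> ?l * (\<epsilon> * sqrt (real r))" by (simp add: mult_ac)
  then have cx: "B c x \<le> \<epsilon> * sqrt (real r)" using l by simp
  have "B c (x \<odot> x) \<le> sqrt (real r) * B c x" using B_square_bound[OF c xK] x(3) by simp
  also have "\<dots> \<le> sqrt (real r) * (\<epsilon> * sqrt (real r))" using cx by (intro mult_left_mono) auto
  finally have cxx: "B c (x \<odot> x) \<le> real r * \<epsilon>" by (simp add: mult_ac)
  have cx2: "(B c x)\<^sup>2 \<le> real r * \<epsilon>\<^sup>2"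
    using power_mono[OF cx cx0, of 2] by (simp add: power_mult_distrib mult_ac)
  have k: "?k > 0" using a by (simp add: add_pos_pos)
  have s: "(1 + a)\<^sup>2 - 1 = ?k" by (simp add: power2_eq_square algebra_simps)
  have "B (?D x) (?D x) = real r + 2 * ?k * B c (x \<odot> x) + ?k\<^sup>2 * (B c x)\<^sup>2"
    unfolding B_D_D[OF c] s x(3) ..
  also have "\<dots> \<le> real r + 2 * ?k * (real r * \<epsilon>) + ?k\<^sup>2 * (real r * \<epsilon>\<^sup>2)"
    using k cxx cx2 by (intro add_mono mult_left_mono) auto
  also have "\<dots> = real r * (1 + ?k * \<epsilon>)\<^sup>2" by (simp add: power2_eq_square algebra_simps)
  finally have norm: "B (?D x) (?D x) \<le> real r * (1 + ?k * \<epsilon>)\<^sup>2" .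
  have pos: "1 + ?k * \<epsilon> > 0" using k eps by (simp add: add_pos_nonneg)
  have D: "jquad jp (e + a *\<^sub>R c) = ?D" by (simp add: D_def[OF c])
  have sub: "subspace (?D ` L)" using D_linear[OF c] L(1) by (rule linear_subspace_image)
  have "(1 + a)\<^sup>2 / (1 + ?k * \<epsilon>) ^ r * jdet jp e x = ((1 + a)\<^sup>2 * jdet jp e x) / (1 + ?k * \<epsilon>) ^ r" by simp
  also have "\<dots> \<le> jdet jp e (?D x) / (1 + ?k * \<epsilon>) ^ r"
    using jdet_D[OF c x(2), of "1 + a"] a pos by (intro divide_right_mono) auto
  also have "\<dots> \<le> jdelta jp e (?D ` L \<inter> jcone jp)"
    using D_jcone[OF c x(2), of "1 + a"] a x(1) by (intro jdelta_lower_bound[OF sub _ norm pos]) auto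
  finally show ?thesis unfolding D x(4) .
qed

end

text \<open>Here \<open>(1 + a)^2 = 2\<close> and \<open>2 a + a^2 = 1\<close>, while the
  denominator is at most exp(1/4), hence at most 21/16 < 4/3, for every \<open>r\<close>; and 2 /
  (4/3) = 3/2.\<close>

lemma scaling_constant:
  assumes "0 < r" "\<epsilon> = 1 / (4 * real r)" "a = sqrt 2 - 1"
  shows "3 / 2 \<le> (1 + a)\<^sup>2 / (1 + (2 * a + a\<^sup>2) * \<epsilon>) ^ r"
proof -
  have a1: "(1 + a)\<^sup>2 = 2" using assms(3) by simp
  have "2 * a + a\<^sup>2 = (1 + a)\<^sup>2 - 1" by (simp add: power2_eq_square algebra_simps)
  with a1 have a: "(1 + a)\<^sup>2 = 2" "2 * a + a\<^sup>2 = 1" by simp_all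
  have "(1 + \<epsilon>) ^ r \<le> exp \<epsilon> ^ r"
    using assms by (intro power_mono exp_ge_add_one_self) auto
  also have "\<dots> = exp (1 / 4)" using assms by (simp add: exp_of_nat_mult[symmetric])
  also have "\<dots> \<le> 1 + 1 / 4 + (1 / 4)\<^sup>2" by (rule exp_bound) auto
  also have "\<dots> \<le> 4 / 3" by (simp add: power2_eq_square)
  finally have "(1 + \<epsilon>) ^ r \<le> 4 / 3" .
  moreover have "0 < (1 + \<epsilon>) ^ r" using assms by (intro zero_less_power) (simp add: add_pos_pos)
  ultimately show ?thesis unfolding a by (simp add: field_simps)
qed

theorem proposition3:
  fixes jp :: "'a::euclidean_space \<Rightarrow> 'a \<Rightarrow> 'a" and e :: 'a
    and L :: "'a set" and z c :: 'a and \<epsilon> a :: real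
  assumes "euclidean_jordan_algebra jp e"
    and "subspace L"
    and "L \<inter> jcone jp \<noteq> {}"
    and "z \<in> closure (jcone jp) - {0}"
    and "jnorm_F jp e (jpos_part jp e (jproj jp e L z)) \<le> \<epsilon> * jnorm_inf jp e z"
    and "primitive_idempotent jp c"
    and "jp z c = jlambda_max jp e z *\<^sub>R c"
    and "a > 0"
  shows "jdelta jp e (jquad jp (e + a *\<^sub>R c) ` L \<inter> jcone jp)
           \<ge> (1 + a)\<^sup>2 / (1 + (2 * a + a\<^sup>2) * \<epsilon>) ^ jrank jp e * jdelta jp e (L \<inter> jcone jp)
       \<and> (\<epsilon> = 1 / (4 * real (jrank jp e)) \<and> a = sqrt 2 - 1 \<longrightarrow>
            jdelta jp e (jquad jp (e + a *\<^sub>R c) ` L \<inter> jcone jp)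
              \<ge> 3 / 2 * jdelta jp e (L \<inter> jcone jp))"
proof -
  interpret E: euclidean_jordan_algebra jp e by fact
  obtain B where "jordan_form jp e B"
    using E.form E.euclidean_jordan_algebra_axioms
    unfolding jordan_form_def jordan_form_axioms_def by blast
  then obtain T where "jordan_trace_form jp e T" using jordan_form.normalized_form by blast
  then interpret T: jordan_trace_form jp e T .
  have main: "(1 + a)\<^sup>2 / (1 + (2 * a + a\<^sup>2) * \<epsilon>) ^ jrank jp e * jdelta jp e (L \<inter> jcone jp)
      \<le> jdelta jp e (jquad jp (e + a *\<^sub>R c) ` L \<inter> jcone jp)"
    by (rule T.jdelta_jquad[OF assms(2-)])
  have "0 < jdelta jp e (L \<inter> jcone jp)"
    using T.jdelta[OF assms(2,3)] T.jdet_pos by (metis IntD2)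
  then have "3 / 2 * jdelta jp e (L \<inter> jcone jp)
      \<le> (1 + a)\<^sup>2 / (1 + (2 * a + a\<^sup>2) * \<epsilon>) ^ jrank jp e * jdelta jp e (L \<inter> jcone jp)"
    if "\<epsilon> = 1 / (4 * real (jrank jp e))" "a = sqrt 2 - 1"
    using scaling_constant[OF T.r_pos that] by (intro mult_right_mono) auto
  with main show ?thesis by (meson order_trans)
qed

end
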